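(* Let $\ell \geq 1$ be an integer, let $G$ be a graph on $n$ vertices, and let $(L,H,R)$ be a partition of $V(G)$ such that $|L| \geq 10|H|\ell$ and every vertex in $L$ has fewer than $\ell$ neighbors in $L \cup R$. Then for every partition $(I,O)$ of $H \cup R$, there are at most $2^{|L|}\cdot e^{-\frac{|L|}{2^{10\ell}\cdot 100\ell^3}}$ minimal $(I,O)$-extensions. Furthermore, all minimal $(I,O)$-extensions can be listed in time $2^{|L|}\cdot e^{-\frac{|L|}{2^{10\ell}\cdot 100\ell^3}}\cdot n^{\mathcal{O}(1)}$.
   Context: All graphs are finite and simple. A vertex set $X$ is a connected dominating set of $G$ if every vertex not in $X$ has a neighbor in $X$ and $G[X]$ is connected. For disjoint vertex sets $I$ and $O$, an $(I,O)$-extension is a vertex set $S$ disjoint from $I \cup O$ such that $I \cup S$ is a connected dominating set of $G$. An $(I,O)$-extension is minimal if no proper subset of it is also an $(I,O)$-extension. *)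

theory Defs
  imports Complex_Main "Graph_Theory.Digraph_Component"
begin

section \<open>Connected dominating sets and extensions\<close>

text \<open>
  A finite simple graph is a symmetric loop-free digraph without parallel arcs, i.e. the
  locale \<^locale>\<open>graph\<close>. The qualified name below avoids the topological
  notion of connectedness.
\<close>

definition neighbors :: "('a, 'b) pre_digraph \<Rightarrow> 'a \<Rightarrow> 'a set" where
  "neighbors G v = {u. v \<rightarrow>\<^bsub>G\<^esub> u}"

definition connected_dominating_set :: "('a, 'b) pre_digraph \<Rightarrow> 'a set \<Rightarrow> bool" where
  "connected_dominating_set G X \<longleftrightarrow>
     X \<subseteq> verts G \<and>
     (\<forall>v \<in> verts G - X. \<exists>u \<in> X. u \<in> neighbors G v) \<and>
     Digraph_Component.connected (G \<restriction> X)"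

definition extension :: "('a, 'b) pre_digraph \<Rightarrow> 'a set \<Rightarrow> 'a set \<Rightarrow> 'a set \<Rightarrow> bool" where
  "extension G In Out S \<longleftrightarrow>
     S \<subseteq> verts G \<and> S \<inter> (In \<union> Out) = {} \<and> connected_dominating_set G (In \<union> S)"

definition minimal_extension :: "('a, 'b) pre_digraph \<Rightarrow> 'a set \<Rightarrow> 'a set \<Rightarrow> 'a set \<Rightarrow> bool" where
  "minimal_extension G In Out S \<longleftrightarrow>
     extension G In Out S \<and> (\<forall>T. T \<subset> S \<longrightarrow> \<not> extension G In Out T)"

definition extension_instance ::
  "nat \<Rightarrow> ('a, 'b) pre_digraph \<Rightarrow> 'a set \<Rightarrow> 'a set \<Rightarrow> 'a set \<Rightarrow> 'a set \<Rightarrow> 'a set \<Rightarrow> bool" where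
  "extension_instance l G L H R In Out \<longleftrightarrow>
     l \<ge> 1 \<and> graph G \<and>
     L \<union> H \<union> R = verts G \<and> L \<inter> H = {} \<and> L \<inter> R = {} \<and> H \<inter> R = {} \<and>
     card L \<ge> 10 * card H * l \<and>
     (\<forall>v \<in> L. card (neighbors G v \<inter> (L \<union> R)) < l) \<and>
     In \<union> Out = H \<union> R \<and> In \<inter> Out = {}"


section \<open>Model of computation\<close>

text \<open>
  Jones' WHILE language on binary trees (Computability and Complexity from a Programming
  Perspective, MIT Press 1997) with its unit-cost time measure. Every charged operation
  (constant nil, variable access, pairing, the two projections, assignment, and test for nil)
  is a constant-time pointer operation on a random access machine; conversely, the language
  simulates a logarithmic-cost random access machine running for time $T$ with overhead
  polynomial in $\log T$ (memory is kept in a balanced tree). Hence the time bound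
  $2^{O(n)} n^{O(1)}$, with a fixed exponential part, has the same meaning in both models.
\<close>

datatype data = DNil | DPair data data

datatype expr = Var nat | NilE | PairE expr expr | Hd expr | Tl expr

datatype prog =
    Assign nat expr
  | Seq prog prog
  | Cond expr prog prog
  | While expr prog

type_synonym store = "nat \<Rightarrow> data"

fun hd_data :: "data \<Rightarrow> data" where
  "hd_data DNil = DNil"
| "hd_data (DPair x y) = x"

fun tl_data :: "data \<Rightarrow> data" where
  "tl_data DNil = DNil"
| "tl_data (DPair x y) = y"

fun eval_expr :: "expr \<Rightarrow> store \<Rightarrow> data" where
  "eval_expr (Var x) s = s x"
| "eval_expr NilE s = DNil"
| "eval_expr (PairE a b) s = DPair (eval_expr a s) (eval_expr b s)"
| "eval_expr (Hd a) s = hd_data (eval_expr a s)"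
| "eval_expr (Tl a) s = tl_data (eval_expr a s)"

fun expr_time :: "expr \<Rightarrow> nat" where
  "expr_time (Var x) = 1"
| "expr_time NilE = 1"
| "expr_time (PairE a b) = 1 + expr_time a + expr_time b"
| "expr_time (Hd a) = 1 + expr_time a"
| "expr_time (Tl a) = 1 + expr_time a"

text \<open>\<open>exec p s t s'\<close>: started in store \<open>s\<close>, \<open>p\<close> halts after \<open>t\<close> steps in store \<open>s'\<close>.\<close>

inductive exec :: "prog \<Rightarrow> store \<Rightarrow> nat \<Rightarrow> store \<Rightarrow> bool" where
  Assign: "exec (Assign x e) s (1 + expr_time e) (s(x := eval_expr e s))"
| Seq: "exec p s t s' \<Longrightarrow> exec q s' u s'' \<Longrightarrow> exec (Seq p q) s (t + u) s''"
| CondTrue: "eval_expr e s \<noteq> DNil \<Longrightarrow> exec p s t s' \<Longrightarrow>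
    exec (Cond e p q) s (1 + expr_time e + t) s'"
| CondFalse: "eval_expr e s = DNil \<Longrightarrow> exec q s t s' \<Longrightarrow>
    exec (Cond e p q) s (1 + expr_time e + t) s'"
| WhileFalse: "eval_expr e s = DNil \<Longrightarrow> exec (While e p) s (1 + expr_time e) s"
| WhileTrue: "eval_expr e s \<noteq> DNil \<Longrightarrow> exec p s t s' \<Longrightarrow> exec (While e p) s' u s'' \<Longrightarrow>
    exec (While e p) s (1 + expr_time e + t + u) s''"

inductive_cases exec_AssignE: "exec (Assign x e) s t s'"
inductive_cases exec_SeqE: "exec (Seq p q) s t s'"
inductive_cases exec_CondE: "exec (Cond e p q) s t s'"
inductive_cases exec_WhileE: "exec (While e p) s t s'"

lemma exec_deterministic:
  "exec p s t s' \<Longrightarrow> exec p s u s'' \<Longrightarrow> u = t \<and> s'' = s'"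
proof (induction arbitrary: u s'' rule: exec.induct)
  case (Assign x e s)
  then show ?case by (auto elim: exec_AssignE)
next
  case (Seq p s t s' q v r)
  from Seq.prems show ?case by (rule exec_SeqE) (auto dest!: Seq.IH)
next
  case (CondTrue e s p t s' q)
  from CondTrue.prems show ?case by (rule exec_CondE) (auto dest!: CondTrue.IH simp: CondTrue.hyps)
next
  case (CondFalse e s q t s' p)
  from CondFalse.prems show ?case by (rule exec_CondE) (auto dest!: CondFalse.IH simp: CondFalse.hyps)
next
  case (WhileFalse e s p)
  from WhileFalse.prems show ?case by (rule exec_WhileE) (auto simp: WhileFalse.hyps)
next
  case (WhileTrue e s p t s' v r)
  from WhileTrue.prems show ?case by (rule exec_WhileE) (auto dest!: WhileTrue.IH simp: WhileTrue.hyps)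
qed

text \<open>Variable 0 holds the input and finally the output; all other variables start as nil.\<close>

definition computes_in_time :: "prog \<Rightarrow> data \<Rightarrow> data \<Rightarrow> nat \<Rightarrow> bool" where
  "computes_in_time p x y t \<longleftrightarrow> (\<exists>s'. exec p ((\<lambda>_. DNil)(0 := x)) t s' \<and> s' 0 = y)"


section \<open>Encoding of inputs and outputs\<close>

text \<open>
  \<open>vs\<close> is a repetition-free list of all vertices. Vertex sets become bit vectors and the
  graph its adjacency matrix, both indexed along \<open>vs\<close>. The parameter \<open>l\<close> is in unary; since
  running times are bounded in terms of the number of vertices and not of the input length,
  this does not enlarge the time budget.
\<close>

definition encode_list :: "data list \<Rightarrow> data" where
  "encode_list xs = foldr DPair xs DNil"

definition encode_bool :: "bool \<Rightarrow> data" where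
  "encode_bool b = (if b then DPair DNil DNil else DNil)"

definition encode_nat :: "nat \<Rightarrow> data" where
  "encode_nat k = encode_list (replicate k DNil)"

definition encode_set :: "'a list \<Rightarrow> 'a set \<Rightarrow> data" where
  "encode_set vs S = encode_list (map (\<lambda>v. encode_bool (v \<in> S)) vs)"

definition encode_graph :: "'a list \<Rightarrow> ('a, 'b) pre_digraph \<Rightarrow> data" where
  "encode_graph vs G = encode_list (map (\<lambda>v. encode_set vs (neighbors G v)) vs)"

definition encode_instance ::
  "'a list \<Rightarrow> nat \<Rightarrow> ('a, 'b) pre_digraph \<Rightarrow> 'a set \<Rightarrow> 'a set \<Rightarrow> 'a set \<Rightarrow> 'a set \<Rightarrow> 'a set \<Rightarrow> data"
where
  "encode_instance vs l G L H R In Out =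
     encode_list [encode_nat l, encode_graph vs G, encode_set vs L, encode_set vs H,
       encode_set vs R, encode_set vs In, encode_set vs Out]"

definition lists_in_time :: "prog \<Rightarrow> data \<Rightarrow> 'a list \<Rightarrow> 'a set set \<Rightarrow> nat \<Rightarrow> bool" where
  "lists_in_time p x vs \<S> t \<longleftrightarrow>
     (\<exists>Ss. distinct Ss \<and> set Ss = \<S> \<and>
        computes_in_time p x (encode_list (map (encode_set vs) Ss)) t)"

end

theory Submission
  imports Defs
begin

text \<open>
  Supersets of connected dominating sets are connected dominating, so minimality only has to be
  tested on the sets \<open>S - {v}\<close>. Let \<open>Z\<close> consist of one vertex from every component of \<open>G[I]\<close> and
  of all vertices outside \<open>I\<close> without a neighbour in \<open>I\<close>. A greedy argument shows that a minimal
  extension has at most \<open>2|Z|\<close> elements. If \<open>|Z|\<close> is at most 49/200 of \<open>|L|\<close>, a Chernoff bound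
  finishes the count. Otherwise, since few parts of \<open>Z\<close> meet \<open>H\<close> and since vertices of \<open>L\<close> have
  fewer than \<open>l\<close> neighbours in \<open>L \<union> R\<close>, many parts have at most \<open>8l\<close> vertices of \<open>L\<close> in their
  closed neighbourhood. Every extension hits each of these blocks, and a linear number of blocks
  is pairwise disjoint, so only an exponentially small fraction of the subsets of \<open>L\<close> survives.

  The listing algorithm decides the vertices of \<open>L\<close> one by one, starting from \<open>X = L\<close>, and keeps
  \<open>X\<close> only if \<open>I \<union> X\<close> is a connected dominating set and at most \<open>2|Z|\<close> decided vertices lie in \<open>X\<close>.
  The counting argument applies verbatim to the sets alive after each round, in whatever order
  the vertices are decided.
\<close>

section \<open>Programs with polynomial overhead\<close>

text \<open>The exponential factor of the running time is prescribed, so every intermediate list of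
  the search, and not only the output, has to respect it. Hence the pruning during the search, the
  family \<open>candidates\<close> with its variable set \<open>P\<close> of decided vertices, and
  the separate parameter \<open>B\<close> in \<open>feasible\<close>, whose degree must be 1 in the
  end. Constant factors are free for the time, but not for the count. The threshold 49/200 sits
  between two demands: 2|Z| has to stay below |L|/2 by a constant fraction, for Chernoff, and 49/200
  has to exceed 1/10 + 1/8, the shares of |L| that bound the number of parts meeting H and of blocks
  larger than 8l; the surplus is 1/50. Hitting the blocks breaks down if I alone is already
  connected dominating, since then an extension may be empty. The empty set is then the only minimal
  extension, but the search still carries other sets. In that case Z has at most one element, so
  Chernoff applies as soon as |L| exceeds 4, and smaller L only cost a constant.\<close>

fun shift_expr :: "nat \<Rightarrow> expr \<Rightarrow> expr" where
  "shift_expr k (Var x) = Var (x + k)"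
| "shift_expr k NilE = NilE"
| "shift_expr k (PairE a b) = PairE (shift_expr k a) (shift_expr k b)"
| "shift_expr k (Hd a) = Hd (shift_expr k a)"
| "shift_expr k (Tl a) = Tl (shift_expr k a)"

fun shift_prog :: "nat \<Rightarrow> prog \<Rightarrow> prog" where
  "shift_prog k (Assign x e) = Assign (x + k) (shift_expr k e)"
| "shift_prog k (Seq p q) = Seq (shift_prog k p) (shift_prog k q)"
| "shift_prog k (Cond e p q) = Cond (shift_expr k e) (shift_prog k p) (shift_prog k q)"
| "shift_prog k (While e p) = While (shift_expr k e) (shift_prog k p)"

text \<open>Variables below \<open>k\<close> are a frame taken from \<open>s0\<close>; the store
  \<open>s\<close> of the relocated program starts at \<open>k\<close>.\<close>

definition shift_store :: "nat \<Rightarrow> store \<Rightarrow> store \<Rightarrow> store" where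
  "shift_store k s0 s = (\<lambda>i. if i < k then s0 i else s (i - k))"

lemma eval_shift_expr: "eval_expr (shift_expr k e) (shift_store k s0 s) = eval_expr e s"
  by (induction e) (auto simp: shift_store_def)

lemma time_shift_expr [simp]: "expr_time (shift_expr k e) = expr_time e"
  by (induction e) auto

lemma exec_AssignI:
  "t = 1 + expr_time e \<Longrightarrow> s' = s(x := eval_expr e s) \<Longrightarrow> exec (Assign x e) s t s'"
  by (simp only: exec.Assign)

lemma exec_shift_store:
  "exec p s t s' \<Longrightarrow> exec (shift_prog k p) (shift_store k s0 s) t (shift_store k s0 s')"
proof (induction rule: exec.induct)
  case (Assign x e s)
  have "shift_store k s0 (s(x := eval_expr e s)) =
      (shift_store k s0 s)(x + k := eval_expr (shift_expr k e) (shift_store k s0 s))"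
    unfolding eval_shift_expr by (rule ext) (auto simp: shift_store_def)
  then show ?case
    using exec.Assign[of "x + k" "shift_expr k e" "shift_store k s0 s"]
    by (simp del: fun_upd_apply)
next
  case (Seq p s t s' q u s'')
  then show ?case by (auto intro: exec.Seq)
next
  case (CondTrue e s p t s' q)
  then show ?case using exec.CondTrue[of "shift_expr k e"] by (simp add: eval_shift_expr)
next
  case (CondFalse e s q t s' p)
  then show ?case using exec.CondFalse[of "shift_expr k e"] by (simp add: eval_shift_expr)
next
  case (WhileFalse e s p)
  then show ?case using exec.WhileFalse[of "shift_expr k e"] by (simp add: eval_shift_expr)
next
  case (WhileTrue e s p t s' u s'')
  then show ?case using exec.WhileTrue[of "shift_expr k e"] by (simp add: eval_shift_expr)
qed

text \<open>Frame rule: the relocated program acts as a subroutine with input and output in variable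
  \<open>k\<close>, and values saved below \<open>k\<close> survive the call.\<close>

lemma exec_shift:
  assumes "exec p (\<lambda>i. s (i + k)) t s'"
  shows "exec (shift_prog k p) s t (\<lambda>i. if i < k then s i else s' (i - k))"
proof -
  have "shift_store k s (\<lambda>i. s (i + k)) = s"
    by (auto simp: shift_store_def)
  then show ?thesis
    using exec_shift_store[OF assms, of k s] by (simp add: shift_store_def)
qed

section \<open>Feasible functions and their closure properties\<close>

class encodable =
  fixes enc :: "'a \<Rightarrow> data"

instantiation unit :: encodable
begin
definition "enc (x :: unit) = DNil"
instance ..
end

instantiation bool :: encodable
begin
definition "enc (b :: bool) = encode_bool b"
instance ..
end

instantiation prod :: (encodable, encodable) encodable
begin
definition "enc x = DPair (enc (fst x)) (enc (snd x))"
instance ..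
end

instantiation list :: (encodable) encodable
begin
definition "enc xs = encode_list (map enc xs)"
instance ..
end

lemma enc_Nil [simp]: "enc [] = DNil"
  and enc_Cons [simp]: "enc (x # xs) = DPair (enc x) (enc xs)"
  by (simp_all add: enc_list_def encode_list_def)

lemma enc_Pair [simp]: "enc (x, y) = DPair (enc x) (enc y)"
  by (simp add: enc_prod_def)

text \<open>
  The start store is arbitrary apart from variable 0, so that programs can be run one after
  another without cleaning up. The domain \<open>P\<close> ties the input to the two size parameters:
  \<open>n\<close> enters polynomially, \<open>B\<close> (an exponential list length) only with the fixed degree \<open>e\<close>.
\<close>

definition feasible ::
  "nat \<Rightarrow> (nat \<Rightarrow> nat \<Rightarrow> 'a \<Rightarrow> bool) \<Rightarrow> ('a::encodable \<Rightarrow> 'b::encodable) \<Rightarrow> bool" where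
  "feasible e P f \<longleftrightarrow> (\<exists>p c. \<forall>n B x s. P n B x \<longrightarrow> s 0 = enc x \<longrightarrow>
     (\<exists>t s'. exec p s t s' \<and> s' 0 = enc (f x) \<and> t \<le> c * (n + 1) ^ c * (B + 1) ^ e))"

lemma cost_mono:
  fixes c d n B e :: nat
  assumes "c \<le> d"
  shows "c * (n + 1) ^ c * (B + 1) ^ e \<le> d * (n + 1) ^ d * (B + 1) ^ e"
  using assms by (intro mult_mono power_increasing) auto

lemma cost_ge: "c \<le> c * (n + 1) ^ c * (B + 1) ^ e" for c n B e :: nat
  by simp

text \<open>One constant serves as factor and as degree, which makes this family of bounds closed
  under addition; running programs in sequence amounts to adding their constants.\<close>

lemma cost_add:
  fixes c d n B e :: nat
  shows "c * (n + 1) ^ c * (B + 1) ^ e + d * (n + 1) ^ d * (B + 1) ^ e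
    \<le> (c + d) * (n + 1) ^ (c + d) * (B + 1) ^ e"
proof -
  have "c * (n + 1) ^ c * (B + 1) ^ e \<le> c * (n + 1) ^ (c + d) * (B + 1) ^ e"
    by (intro mult_mono power_increasing) auto
  moreover have "d * (n + 1) ^ d * (B + 1) ^ e \<le> d * (n + 1) ^ (c + d) * (B + 1) ^ e"
    by (intro mult_mono power_increasing) auto
  ultimately show ?thesis unfolding add_mult_distrib by (rule add_mono)
qed

lemma feasibleE:
  assumes "feasible e P f"
  obtains p c where "\<And>n B x s. P n B x \<Longrightarrow> s 0 = enc x \<Longrightarrow>
     \<exists>t s'. exec p s t s' \<and> s' 0 = enc (f x) \<and> t \<le> c * (n + 1) ^ c * (B + 1) ^ e"
proof -
  from assms obtain p c where "\<forall>n B x s. P n B x \<longrightarrow> s 0 = enc x \<longrightarrow>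
     (\<exists>t s'. exec p s t s' \<and> s' 0 = enc (f x) \<and> t \<le> c * (n + 1) ^ c * (B + 1) ^ e)"
    unfolding feasible_def by blast
  then show thesis by (intro that[of p c]) blast
qed

lemma feasibleI:
  assumes "\<And>n B x s. P n B x \<Longrightarrow> s 0 = enc x \<Longrightarrow>
     \<exists>t s'. exec p s t s' \<and> s' 0 = enc (f x) \<and> t \<le> c * (n + 1) ^ c * (B + 1) ^ e"
  shows "feasible e P f"
  using assms unfolding feasible_def by blast

lemma feasible_mono:
  assumes "feasible e Q f" "\<And>n B x. P n B x \<Longrightarrow> Q n B x" "e \<le> e'"
  shows "feasible e' P f"
proof -
  obtain p c where p: "\<And>n B x s. Q n B x \<Longrightarrow> s 0 = enc x \<Longrightarrow>
     \<exists>t s'. exec p s t s' \<and> s' 0 = enc (f x) \<and> t \<le> c * (n + 1) ^ c * (B + 1) ^ e"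
    using assms(1) by (rule feasibleE) (rule that)
  have "c * (n + 1) ^ c * (B + 1) ^ e \<le> c * (n + 1) ^ c * (B + 1) ^ e'" for n B :: nat
    using assms(3) by (intro mult_mono power_increasing) auto
  then show ?thesis
    using p assms(2) by (intro feasibleI[of P p f c e']) (meson le_trans)
qed

lemma feasible_expr:
  assumes "\<And>n B x s. P n B x \<Longrightarrow> s 0 = enc x \<Longrightarrow> eval_expr a s = enc (f x)"
  shows "feasible e P f"
proof (rule feasibleI[where p = "Assign 0 a" and c = "1 + expr_time a"])
  fix n B x and s :: store assume "P n B x" "s 0 = enc x"
  then show "\<exists>t s'. exec (Assign 0 a) s t s' \<and> s' 0 = enc (f x) \<and>
      t \<le> (1 + expr_time a) * (n + 1) ^ (1 + expr_time a) * (B + 1) ^ e"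
    using exec.Assign[of 0 a s] cost_ge[of "1 + expr_time a" n B e] assms by fastforce
qed

lemma feasible_id: "feasible e P (\<lambda>x. x)"
  by (rule feasible_expr[of P "Var 0"]) simp

text \<open>The size parameters are not computed from the input, so the same \<open>n\<close> and
  \<open>B\<close> serve for \<open>x\<close> and for \<open>f x\<close>: costs add, and no
  polynomials have to be composed.\<close>

lemma feasible_comp:
  assumes f: "feasible e P f" and g: "feasible e Q g"
    and PQ: "\<And>n B x. P n B x \<Longrightarrow> Q n B (f x)"
  shows "feasible e P (\<lambda>x. g (f x))"
proof -
  obtain p c where p: "\<And>n B x s. P n B x \<Longrightarrow> s 0 = enc x \<Longrightarrow>
     \<exists>t s'. exec p s t s' \<and> s' 0 = enc (f x) \<and> t \<le> c * (n + 1) ^ c * (B + 1) ^ e"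
    using f by (rule feasibleE) (rule that)
  obtain q d where q: "\<And>n B x s. Q n B x \<Longrightarrow> s 0 = enc x \<Longrightarrow>
     \<exists>t s'. exec q s t s' \<and> s' 0 = enc (g x) \<and> t \<le> d * (n + 1) ^ d * (B + 1) ^ e"
    using g by (rule feasibleE) (rule that)
  show ?thesis
  proof (rule feasibleI[where p = "Seq p q" and c = "c + d"])
    fix n B x and s :: store assume "P n B x" "s 0 = enc x"
    with p obtain t s' where 1: "exec p s t s'" "s' 0 = enc (f x)"
        "t \<le> c * (n + 1) ^ c * (B + 1) ^ e" by blast
    with q PQ \<open>P n B x\<close> obtain u s'' where 2: "exec q s' u s''" "s'' 0 = enc (g (f x))"
        "u \<le> d * (n + 1) ^ d * (B + 1) ^ e" by blast
    show "\<exists>t s'. exec (Seq p q) s t s' \<and> s' 0 = enc (g (f x)) \<and>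
        t \<le> (c + d) * (n + 1) ^ (c + d) * (B + 1) ^ e"
      using exec.Seq[OF 1(1) 2(1)] 2(2) 1(3) 2(3) cost_add[of c n B e d] by (meson add_mono le_trans)
  qed
qed

lemma feasible_expr_comp:
  assumes "feasible e P f"
    and "\<And>n B x s. P n B x \<Longrightarrow> s 0 = enc (f x) \<Longrightarrow> eval_expr a s = enc (g (f x))"
  shows "feasible e P (\<lambda>x. g (f x))"
proof (rule feasible_comp[OF assms(1), where Q = "\<lambda>n B y. \<exists>x. P n B x \<and> y = f x"])
  show "feasible e (\<lambda>n B y. \<exists>x. P n B x \<and> y = f x) g"
    by (rule feasible_expr[where a = a]) (use assms(2) in blast)
qed blast

lemma feasible_fst: "feasible e P f \<Longrightarrow> feasible e P (\<lambda>x. fst (f x))"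
  by (erule feasible_expr_comp[where a = "Hd (Var 0)"]) (simp add: enc_prod_def)

lemma feasible_snd: "feasible e P f \<Longrightarrow> feasible e P (\<lambda>x. snd (f x))"
  by (erule feasible_expr_comp[where a = "Tl (Var 0)"]) (simp add: enc_prod_def)

lemma feasible_tl: "feasible e P f \<Longrightarrow> feasible e P (\<lambda>x. tl (f x))"
proof (erule feasible_expr_comp[where a = "Tl (Var 0)"])
  fix x and s :: store assume "s 0 = enc (f x)"
  then show "eval_expr (Tl (Var 0)) s = enc (tl (f x))"
    by (cases "f x") auto
qed

text \<open>Unlike \<open>tl []\<close>, which matches the default of \<open>tl_data\<close>,
  \<open>hd []\<close> is unspecified, so the empty list must be excluded.\<close>

lemma feasible_hd:
  assumes "feasible e P f" "\<And>n B x. P n B x \<Longrightarrow> f x \<noteq> []"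
  shows "feasible e P (\<lambda>x. hd (f x))"
proof (rule feasible_expr_comp[OF assms(1), where a = "Hd (Var 0)"])
  fix n B x and s :: store assume "P n B x" "s 0 = enc (f x)"
  then show "eval_expr (Hd (Var 0)) s = enc (hd (f x))"
    using assms(2)[of n B x] by (cases "f x") auto
qed

fun constant_expr :: "data \<Rightarrow> expr" where
  "constant_expr DNil = NilE"
| "constant_expr (DPair x y) = PairE (constant_expr x) (constant_expr y)"

lemma eval_constant_expr [simp]: "eval_expr (constant_expr d) s = d"
  by (induction d) auto

lemma feasible_const: "feasible e P (\<lambda>x. c)"
  by (rule feasible_expr[of P "constant_expr (enc c)"]) simp

lemma feasible_Pair:
  assumes f: "feasible e P f" and g: "feasible e P g"
  shows "feasible e P (\<lambda>x. (f x, g x))"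
proof -
  obtain p c where p: "\<And>n B x s. P n B x \<Longrightarrow> s 0 = enc x \<Longrightarrow>
     \<exists>t s'. exec p s t s' \<and> s' 0 = enc (f x) \<and> t \<le> c * (n + 1) ^ c * (B + 1) ^ e"
    using f by (rule feasibleE) (rule that)
  obtain q d where q: "\<And>n B x s. P n B x \<Longrightarrow> s 0 = enc x \<Longrightarrow>
     \<exists>t s'. exec q s t s' \<and> s' 0 = enc (g x) \<and> t \<le> d * (n + 1) ^ d * (B + 1) ^ e"
    using g by (rule feasibleE) (rule that)
  \<comment> \<open>The input stays in variable 0. A copy in variable 1 is the input of
    \<open>p\<close>, whose result remains there; \<open>q\<close> then works on a second copy from
    variable 2 upwards.\<close>
  let ?p = "Seq (Assign 1 (Var 0)) (Seq (shift_prog 1 p)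
     (Seq (Assign 2 (Var 0)) (Seq (shift_prog 2 q) (Assign 0 (PairE (Var 1) (Var 2))))))"
  show ?thesis
  proof (rule feasibleI[where p = ?p and c = "c + d + 8"])
    fix n B x and s :: store assume P: "P n B x" and s: "s 0 = enc x"
    define s1 where "s1 = s(1 := s 0)"
    have e1: "exec (Assign 1 (Var 0)) s 2 s1"
      by (rule exec_AssignI) (simp_all add: s1_def)
    obtain t1 s2' where 2: "exec p (\<lambda>i. s1 (i + 1)) t1 s2'" "s2' 0 = enc (f x)"
        "t1 \<le> c * (n + 1) ^ c * (B + 1) ^ e"
      using p[of n B x "\<lambda>i. s1 (i + 1)"] P s by (auto simp: s1_def)
    define s2 where "s2 = (\<lambda>i. if i < 1 then s1 i else s2' (i - 1))"
    have e2: "exec (shift_prog 1 p) s1 t1 s2"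
      unfolding s2_def by (rule exec_shift[OF 2(1)])
    define s3 where "s3 = s2(2 := s2 0)"
    have e3: "exec (Assign 2 (Var 0)) s2 2 s3"
      by (rule exec_AssignI) (simp_all add: s3_def)
    have "s3 2 = enc x" by (simp add: s3_def s2_def s1_def s)
    then obtain t2 s4' where 4: "exec q (\<lambda>i. s3 (i + 2)) t2 s4'" "s4' 0 = enc (g x)"
        "t2 \<le> d * (n + 1) ^ d * (B + 1) ^ e"
      using q[of n B x "\<lambda>i. s3 (i + 2)"] P by (auto simp: numeral_2_eq_2)
    define s4 where "s4 = (\<lambda>i. if i < 2 then s3 i else s4' (i - 2))"
    have e4: "exec (shift_prog 2 q) s3 t2 s4"
      unfolding s4_def by (rule exec_shift[OF 4(1)])
    have "s4 1 = enc (f x)" "s4 2 = enc (g x)"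
      by (simp_all add: s4_def s3_def s2_def 2 4)
    then have "exec (Assign 0 (PairE (Var 1) (Var 2))) s4 4 (s4(0 := enc (f x, g x)))"
      by (intro exec_AssignI) simp_all
    then have ex: "exec ?p s (2 + (t1 + (2 + (t2 + 4)))) (s4(0 := enc (f x, g x)))"
      using exec.Seq[OF e1 exec.Seq[OF e2 exec.Seq[OF e3 exec.Seq[OF e4]]]] by blast
    have "2 + (t1 + (2 + (t2 + 4))) \<le> (c * (n + 1) ^ c * (B + 1) ^ e + d * (n + 1) ^ d * (B + 1) ^ e) + 8"
      using 2(3) 4(3) by linarith
    also have "\<dots> \<le> (c + d) * (n + 1) ^ (c + d) * (B + 1) ^ e + 8 * (n + 1) ^ 8 * (B + 1) ^ e"
      by (intro add_mono cost_add cost_ge)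
    also have "\<dots> \<le> (c + d + 8) * (n + 1) ^ (c + d + 8) * (B + 1) ^ e"
      by (rule cost_add)
    finally show "\<exists>t s'. exec ?p s t s' \<and> s' 0 = enc (f x, g x) \<and>
        t \<le> (c + d + 8) * (n + 1) ^ (c + d + 8) * (B + 1) ^ e"
      using ex by (metis fun_upd_same)
  qed
qed

text \<open>Pairs and list cells are encoded by the same \<open>DPair\<close>, so turning one into
  the other costs only a copy.\<close>

lemma feasible_Cons:
  assumes "feasible e P f" "feasible e P g"
  shows "feasible e P (\<lambda>x. f x # g x)"
  using feasible_expr_comp[OF feasible_Pair[OF assms],
      where a = "Var 0" and g = "\<lambda>y. fst y # snd y"] by simp

text \<open>Each branch is verified only on inputs that reach it. Testing the encoding against nil
  serves truth values and lists alike.\<close>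

lemma feasible_case_data:
  assumes b: "feasible e P b"
    and f: "feasible e (\<lambda>n B x. P n B x \<and> enc (b x) \<noteq> DNil) f"
    and g: "feasible e (\<lambda>n B x. P n B x \<and> enc (b x) = DNil) g"
  shows "feasible e P (\<lambda>x. if enc (b x) \<noteq> DNil then f x else g x)"
proof -
  obtain r k where r: "\<And>n B x s. P n B x \<Longrightarrow> s 0 = enc x \<Longrightarrow>
     \<exists>t s'. exec r s t s' \<and> s' 0 = enc (b x) \<and> t \<le> k * (n + 1) ^ k * (B + 1) ^ e"
    using b by (rule feasibleE) (rule that)
  obtain p c where p: "\<And>n B x s. P n B x \<and> enc (b x) \<noteq> DNil \<Longrightarrow> s 0 = enc x \<Longrightarrow>
     \<exists>t s'. exec p s t s' \<and> s' 0 = enc (f x) \<and> t \<le> c * (n + 1) ^ c * (B + 1) ^ e"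
    using f by (rule feasibleE) (rule that)
  obtain q d where q: "\<And>n B x s. P n B x \<and> enc (b x) = DNil \<Longrightarrow> s 0 = enc x \<Longrightarrow>
     \<exists>t s'. exec q s t s' \<and> s' 0 = enc (g x) \<and> t \<le> d * (n + 1) ^ d * (B + 1) ^ e"
    using g by (rule feasibleE) (rule that)
  let ?p = "Seq (Assign 1 (Var 0)) (Seq (shift_prog 1 r) (Cond (Var 1) p q))"
  show ?thesis
  proof (rule feasibleI[where p = ?p and c = "k + (c + d) + 4"])
    fix n B x and s :: store assume P: "P n B x" and s: "s 0 = enc x"
    define s1 where "s1 = s(1 := s 0)"
    have e1: "exec (Assign 1 (Var 0)) s 2 s1"
      by (rule exec_AssignI) (simp_all add: s1_def)
    obtain t1 s2' where 2: "exec r (\<lambda>i. s1 (i + 1)) t1 s2'" "s2' 0 = enc (b x)"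
        "t1 \<le> k * (n + 1) ^ k * (B + 1) ^ e"
      using r[of n B x "\<lambda>i. s1 (i + 1)"] P s by (auto simp: s1_def)
    define s2 where "s2 = (\<lambda>i. if i < 1 then s1 i else s2' (i - 1))"
    have e2: "exec (shift_prog 1 r) s1 t1 s2"
      unfolding s2_def by (rule exec_shift[OF 2(1)])
    have s2: "s2 0 = enc x" "s2 1 = enc (b x)"
      by (simp_all add: s2_def s1_def s 2)
    have "\<exists>t s'. exec (Cond (Var 1) p q) s2 (2 + t) s' \<and>
        s' 0 = enc (if enc (b x) \<noteq> DNil then f x else g x) \<and>
        t \<le> (c + d) * (n + 1) ^ (c + d) * (B + 1) ^ e"
    proof (cases "enc (b x) = DNil")
      case True
      then obtain t s' where 3: "exec q s2 t s'" "s' 0 = enc (g x)"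
          "t \<le> d * (n + 1) ^ d * (B + 1) ^ e"
        using q[of n B x s2] P s2 by auto
      then show ?thesis
        using exec.CondFalse[OF _ 3(1), of "Var 1" p] True s2 cost_mono[of d "c + d" n B e]
        by (fastforce intro: le_trans)
    next
      case False
      then obtain t s' where 3: "exec p s2 t s'" "s' 0 = enc (f x)"
          "t \<le> c * (n + 1) ^ c * (B + 1) ^ e"
        using p[of n B x s2] P s2 by auto
      then show ?thesis
        using exec.CondTrue[OF _ 3(1), of "Var 1" q] False s2 cost_mono[of c "c + d" n B e]
        by (fastforce intro: le_trans)
    qed
    then obtain t s' where 3: "exec (Cond (Var 1) p q) s2 (2 + t) s'"
        "s' 0 = enc (if enc (b x) \<noteq> DNil then f x else g x)"
        "t \<le> (c + d) * (n + 1) ^ (c + d) * (B + 1) ^ e"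
      by blast
    have ex: "exec ?p s (2 + (t1 + (2 + t))) s'"
      by (rule exec.Seq[OF e1 exec.Seq[OF e2 3(1)]])
    have "2 + (t1 + (2 + t)) \<le>
        (k * (n + 1) ^ k * (B + 1) ^ e + (c + d) * (n + 1) ^ (c + d) * (B + 1) ^ e) + 4"
      using 2(3) 3(3) by linarith
    also have "\<dots> \<le> (k + (c + d)) * (n + 1) ^ (k + (c + d)) * (B + 1) ^ e
        + 4 * (n + 1) ^ 4 * (B + 1) ^ e"
      by (intro add_mono cost_add cost_ge)
    also have "\<dots> \<le> (k + (c + d) + 4) * (n + 1) ^ (k + (c + d) + 4) * (B + 1) ^ e"
      by (rule cost_add)
    finally show "\<exists>t s'. exec ?p s t s' \<and>
        s' 0 = enc (if enc (b x) \<noteq> DNil then f x else g x) \<and>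
        t \<le> (k + (c + d) + 4) * (n + 1) ^ (k + (c + d) + 4) * (B + 1) ^ e"
      using ex 3(2) by blast
  qed
qed

lemma feasible_if:
  assumes b: "feasible e P b"
    and f: "feasible e (\<lambda>n B x. P n B x \<and> b x) f"
    and g: "feasible e (\<lambda>n B x. P n B x \<and> \<not> b x) g"
  shows "feasible e P (\<lambda>x. if b x then f x else g x)"
proof -
  have [simp]: "enc c = DNil \<longleftrightarrow> \<not> c" for c :: bool
    by (simp add: enc_bool_def encode_bool_def)
  show ?thesis
    using feasible_case_data[of e P b f g] assms by simp
qed

lemma feasible_if_null:
  assumes l: "feasible e P l"
    and f: "feasible e (\<lambda>n B x. P n B x \<and> l x = []) f"
    and g: "feasible e (\<lambda>n B x. P n B x \<and> l x \<noteq> []) g"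
  shows "feasible e P (\<lambda>x. if l x = [] then f x else g x)"
proof -
  have [simp]: "enc (ys :: 'x::encodable list) = DNil \<longleftrightarrow> ys = []" for ys
    by (cases ys) auto
  have "feasible e P (\<lambda>x. if enc (l x) \<noteq> DNil then g x else f x)"
    using assms by (intro feasible_case_data) auto
  moreover have "(\<lambda>x. if enc (l x) \<noteq> DNil then g x else f x) = (\<lambda>x. if l x = [] then f x else g x)"
    by auto
  ultimately show ?thesis by simp
qed

text \<open>Degrees in \<open>B\<close> add up: \<open>e1\<close> for one round, \<open>e2\<close>
  for the number of rounds. The body only ever sees partial results that really occur, which matters
  when their size is known from an argument about the fold itself.\<close>

lemma feasible_foldl:
  fixes h :: "'a::encodable \<Rightarrow> 'b::encodable \<Rightarrow> 'c::encodable \<Rightarrow> 'b"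
  assumes l: "feasible (e1 + e2) P l" and i: "feasible (e1 + e2) P i"
    and h: "feasible e1 Q (\<lambda>y. h (fst y) (fst (snd y)) (snd (snd y)))"
    and Q: "\<And>n B x j. P n B x \<Longrightarrow> j < length (l x) \<Longrightarrow>
      Q n B (x, foldl (h x) (i x) (take j (l x)), l x ! j)"
    and len: "\<And>n B x. P n B x \<Longrightarrow> length (l x) \<le> k * (n + 1) * (B + 1) ^ e2"
  shows "feasible (e1 + e2) P (\<lambda>x. foldl (h x) (i x) (l x))"
proof -
  obtain p c where p: "\<And>n B x s. Q n B x \<Longrightarrow> s 0 = enc x \<Longrightarrow>
     \<exists>t s'. exec p s t s' \<and> s' 0 = enc (h (fst x) (fst (snd x)) (snd (snd x))) \<and>
       t \<le> c * (n + 1) ^ c * (B + 1) ^ e1"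
    using h by (rule feasibleE) (rule that)
  obtain q d where q: "\<And>n B x s. P n B x \<Longrightarrow> s 0 = enc x \<Longrightarrow>
     \<exists>t s'. exec q s t s' \<and> s' 0 = enc (x, i x, l x) \<and>
       t \<le> d * (n + 1) ^ d * (B + 1) ^ (e1 + e2)"
    using feasible_Pair[OF feasible_id feasible_Pair[OF i l]] by (rule feasibleE) (rule that)
  \<comment> \<open>Variable 0 keeps \<open>x\<close>, variable 1 the accumulator, variable 2 the
    rest of the list; the body runs from variable 3 upwards.\<close>
  let ?body = "Seq (Assign 3 (PairE (Var 0) (PairE (Var 1) (Hd (Var 2)))))
     (Seq (shift_prog 3 p) (Seq (Assign 1 (Var 3)) (Assign 2 (Tl (Var 2)))))"
  let ?p = "Seq q (Seq (Assign 1 (Hd (Tl (Var 0)))) (Seq (Assign 2 (Tl (Tl (Var 0))))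
     (Seq (Assign 0 (Hd (Var 0))) (Seq (While (Var 2) ?body) (Assign 0 (Var 1))))))"
  \<comment> \<open>Each round pays 14 for the successful test and the three assignments (2 + 7 + 2
    + 3); the leading 2 is the failing last test.\<close>
  have loop: "\<exists>t s'. exec (While (Var 2) ?body) s t s' \<and> s' 1 = enc (foldl (h x) (i x) (l x)) \<and>
      t \<le> 2 + (length (l x) - j) * (c * (n + 1) ^ c * (B + 1) ^ e1 + 14)"
    if P: "P n B x" and j: "j \<le> length (l x)" and s: "s 0 = enc x"
      "s 1 = enc (foldl (h x) (i x) (take j (l x)))" "s 2 = enc (drop j (l x))"
    for n B x j s
    using j s
  proof (induction "length (l x) - j" arbitrary: j s)
    case 0
    then have "exec (While (Var 2) ?body) s 2 s"
      using exec.WhileFalse[of "Var 2" s ?body] by (simp add: numeral_2_eq_2)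
    then show ?case using 0 by fastforce
  next
    case (Suc m)
    then have j: "j < length (l x)" by simp
    have dr: "drop j (l x) = l x ! j # drop (Suc j) (l x)"
      using j by (simp add: Cons_nth_drop_Suc)
    let ?a = "foldl (h x) (i x) (take j (l x))"
    define s1 where "s1 = s(3 := enc (x, ?a, l x ! j))"
    have e1: "exec (Assign 3 (PairE (Var 0) (PairE (Var 1) (Hd (Var 2))))) s 7 s1"
      by (rule exec_AssignI) (simp_all add: s1_def Suc.prems dr del: One_nat_def)
    obtain t1 s2' where 2: "exec p (\<lambda>i. s1 (i + 3)) t1 s2'" "s2' 0 = enc (h x ?a (l x ! j))"
        "t1 \<le> c * (n + 1) ^ c * (B + 1) ^ e1"
      using p[OF Q[OF P j], of "\<lambda>i. s1 (i + 3)"] by (auto simp: s1_def)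
    define s2 where "s2 = (\<lambda>i. if i < 3 then s1 i else s2' (i - 3))"
    have e2: "exec (shift_prog 3 p) s1 t1 s2"
      unfolding s2_def by (rule exec_shift[OF 2(1)])
    define s3 where "s3 = s2(1 := s2 3)"
    have e3: "exec (Assign 1 (Var 3)) s2 2 s3"
      by (rule exec_AssignI) (simp_all add: s3_def)
    define s4 where "s4 = s3(2 := tl_data (s3 2))"
    have e4: "exec (Assign 2 (Tl (Var 2))) s3 3 s4"
      by (rule exec_AssignI) (simp_all add: s4_def)
    have body: "exec ?body s (7 + (t1 + (2 + 3))) s4"
      by (rule exec.Seq[OF e1 exec.Seq[OF e2 exec.Seq[OF e3 e4]]])
    have s4: "s4 0 = enc x" "s4 1 = enc (foldl (h x) (i x) (take (Suc j) (l x)))"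
        "s4 2 = enc (drop (Suc j) (l x))"
      using Suc.prems j
      by (simp_all add: s4_def s3_def s2_def s1_def 2 dr take_Suc_conv_app_nth)
    have m: "m = length (l x) - Suc j" "Suc j \<le> length (l x)"
      using Suc.hyps(2) j by auto
    obtain t s' where 5: "exec (While (Var 2) ?body) s4 t s'"
        "s' 1 = enc (foldl (h x) (i x) (l x))"
        "t \<le> 2 + (length (l x) - Suc j) * (c * (n + 1) ^ c * (B + 1) ^ e1 + 14)"
      using Suc.hyps(1)[OF m s4] by blast
    have "exec (While (Var 2) ?body) s (1 + 1 + (7 + (t1 + (2 + 3))) + t) s'"
      using exec.WhileTrue[OF _ body 5(1)] Suc.prems dr by simp
    moreover have "1 + 1 + (7 + (t1 + (2 + 3))) + t
        \<le> 2 + (length (l x) - j) * (c * (n + 1) ^ c * (B + 1) ^ e1 + 14)"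
    proof -
      have "length (l x) - j = Suc (length (l x) - Suc j)" using j by simp
      then show ?thesis using 5(3) 2(3) by simp
    qed
    ultimately show ?case using 5(2) by blast
  qed
  define K where "K = k * (c + 14)"
  show ?thesis
  proof (rule feasibleI[where p = ?p and c = "d + (K + c + 1) + 20"])
    fix n B x and s :: store assume P: "P n B x" and s: "s 0 = enc x"
    obtain t0 s1 where 1: "exec q s t0 s1" "s1 0 = enc (x, i x, l x)"
       "t0 \<le> d * (n + 1) ^ d * (B + 1) ^ (e1 + e2)"
      using q[of n B x s] P s by blast
    define s2 where "s2 = s1(1 := enc (i x))"
    define s3 where "s3 = s2(2 := enc (l x))"
    define s4 where "s4 = s3(0 := enc x)"
    have e2: "exec (Assign 1 (Hd (Tl (Var 0)))) s1 4 s2"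
      by (rule exec_AssignI) (simp_all add: s2_def 1)
    have e3: "exec (Assign 2 (Tl (Tl (Var 0)))) s2 4 s3"
      by (rule exec_AssignI) (simp_all add: s2_def s3_def 1)
    have e4: "exec (Assign 0 (Hd (Var 0))) s3 3 s4"
      by (rule exec_AssignI) (simp_all add: s2_def s3_def s4_def 1)
    obtain t s5 where 5: "exec (While (Var 2) ?body) s4 t s5"
        "s5 1 = enc (foldl (h x) (i x) (l x))"
        "t \<le> 2 + length (l x) * (c * (n + 1) ^ c * (B + 1) ^ e1 + 14)"
      using loop[OF P, of 0 s4] by (auto simp: s4_def s3_def s2_def)
    have e6: "exec (Assign 0 (Var 1)) s5 2 (s5(0 := s5 1))"
      by (rule exec_AssignI) simp_all
    have ex: "exec ?p s (t0 + (4 + (4 + (3 + (t + 2))))) (s5(0 := s5 1))"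
      by (rule exec.Seq[OF 1(1) exec.Seq[OF e2 exec.Seq[OF e3 exec.Seq[OF e4 exec.Seq[OF 5(1) e6]]]]])
    have "length (l x) * (c * (n + 1) ^ c * (B + 1) ^ e1 + 14)
        \<le> (k * (n + 1) * (B + 1) ^ e2) * ((c + 14) * (n + 1) ^ c * (B + 1) ^ e1)"
      using len[OF P] by (intro mult_mono) (simp_all add: algebra_simps)
    also have "\<dots> = K * (n + 1) ^ (c + 1) * (B + 1) ^ (e1 + e2)"
      by (simp add: K_def power_add algebra_simps)
    also have "\<dots> \<le> (K + c + 1) * (n + 1) ^ (K + c + 1) * (B + 1) ^ (e1 + e2)"
      by (intro mult_mono power_increasing) auto
    finally have "t0 + (4 + (4 + (3 + (t + 2)))) \<le> (d * (n + 1) ^ d * (B + 1) ^ (e1 + e2) +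
        (K + c + 1) * (n + 1) ^ (K + c + 1) * (B + 1) ^ (e1 + e2)) + 20"
      using 1(3) 5(3) by linarith
    also have "\<dots> \<le> (d + (K + c + 1)) * (n + 1) ^ (d + (K + c + 1)) * (B + 1) ^ (e1 + e2)
        + 20 * (n + 1) ^ 20 * (B + 1) ^ (e1 + e2)"
      by (intro add_mono cost_add cost_ge)
    also have "\<dots> \<le> (d + (K + c + 1) + 20) * (n + 1) ^ (d + (K + c + 1) + 20) * (B + 1) ^ (e1 + e2)"
      by (rule cost_add)
    finally show "\<exists>t s'. exec ?p s t s' \<and> s' 0 = enc (foldl (h x) (i x) (l x)) \<and>
        t \<le> (d + (K + c + 1) + 20) * (n + 1) ^ (d + (K + c + 1) + 20) * (B + 1) ^ (e1 + e2)"
      using ex 5(2) by (metis fun_upd_same)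
  qed
qed

lemma feasible_foldl_short:
  fixes h :: "'a::encodable \<Rightarrow> 'b::encodable \<Rightarrow> 'c::encodable \<Rightarrow> 'b"
  assumes "feasible e P l" "feasible e P i"
    and "feasible e (\<lambda>n B y. P n B (fst y) \<and> snd (snd y) \<in> set (l (fst y)))
      (\<lambda>y. h (fst y) (fst (snd y)) (snd (snd y)))"
    and "\<And>n B x. P n B x \<Longrightarrow> length (l x) \<le> n"
  shows "feasible e P (\<lambda>x. foldl (h x) (i x) (l x))"
proof -
  have "feasible (e + 0) P (\<lambda>x. foldl (h x) (i x) (l x))"
  proof (rule feasible_foldl[where k = 1])
    show "feasible e (\<lambda>n B y. P n B (fst y) \<and> snd (snd y) \<in> set (l (fst y)))
      (\<lambda>y. h (fst y) (fst (snd y)) (snd (snd y)))" by (rule assms(3))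
  qed (use assms(1,2,4) le_Suc_eq in \<open>auto simp: le_SucI\<close>)
  then show ?thesis by simp
qed

lemma feasible_rev:
  assumes "feasible e P l" "\<And>n B x. P n B x \<Longrightarrow> length (l x) \<le> n"
  shows "feasible e P (\<lambda>x. rev (l x))"
proof -
  have rev: "rev xs = foldl (\<lambda>acc a. a # acc) [] xs" for xs :: "'x list"
    by (simp add: foldl_conv_fold rev_conv_fold)
  show ?thesis
    unfolding rev 
    by (intro feasible_foldl_short feasible_const feasible_Cons feasible_fst
        feasible_snd feasible_id assms)
qed

lemma feasible_map:
  assumes l: "feasible e P l" "\<And>n B x. P n B x \<Longrightarrow> length (l x) \<le> n"
    and h: "feasible e (\<lambda>n B y. P n B (fst y) \<and> snd y \<in> set (l (fst y))) (\<lambda>y. h (fst y) (snd y))"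
  shows "feasible e P (\<lambda>x. map (h x) (l x))"
proof -
  have fold: "foldl (\<lambda>acc a. f a # acc) acc xs = rev (map f xs) @ acc" for f :: "'x \<Rightarrow> 'y" and acc xs
    by (induction xs arbitrary: acc) auto
  have h': "feasible e (\<lambda>n B y. P n B (fst y) \<and> snd (snd y) \<in> set (l (fst y)))
      (\<lambda>y. h (fst y) (snd (snd y)))"
    using feasible_comp[OF feasible_Pair[OF feasible_fst[OF feasible_id]
          feasible_snd[OF feasible_snd[OF feasible_id]]] h] by simp
  have "feasible e P (\<lambda>x. rev (foldl (\<lambda>acc a. h x a # acc) [] (l x)))"
    by (intro feasible_rev feasible_foldl_short feasible_const feasible_Cons h' feasible_fst
        feasible_snd feasible_id assms(1)) (auto simp: fold l(2))
  then show ?thesis by (simp add: fold)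
qed

lemma feasible_not:
  assumes "feasible e P b"
  shows "feasible e P (\<lambda>x. \<not> b x)"
proof -
  have "feasible e P (\<lambda>x. if b x then False else True)"
    by (intro feasible_if feasible_const assms)
  moreover have "(\<lambda>x. if b x then False else True) = (\<lambda>x. \<not> b x)" by auto
  ultimately show ?thesis by (simp only:)
qed

lemma feasible_conj:
  assumes "feasible e P f" "feasible e P g"
  shows "feasible e P (\<lambda>x. f x \<and> g x)"
proof -
  have "feasible e P (\<lambda>x. if f x then g x else False)"
    by (intro feasible_if feasible_const assms(1) feasible_mono[OF assms(2) _ order_refl]) auto
  moreover have "(\<lambda>x. if f x then g x else False) = (\<lambda>x. f x \<and> g x)" by auto
  ultimately show ?thesis by (simp only:)
qed

lemma feasible_disj:
  assumes "feasible e P f" "feasible e P g"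
  shows "feasible e P (\<lambda>x. f x \<or> g x)"
  using feasible_not[OF feasible_conj[OF feasible_not[OF assms(1)] feasible_not[OF assms(2)]]]
  by simp

lemma feasible_imp:
  assumes "feasible e P f" "feasible e P g"
  shows "feasible e P (\<lambda>x. f x \<longrightarrow> g x)"
  using feasible_disj[OF feasible_not[OF assms(1)] assms(2)] by (simp only: imp_conv_disj)

lemma feasible_bex:
  assumes l: "feasible e P l" "\<And>n B x. P n B x \<Longrightarrow> length (l x) \<le> n"
    and h: "feasible e (\<lambda>n B y. P n B (fst y) \<and> snd y \<in> set (l (fst y))) (\<lambda>y. h (fst y) (snd y))"
  shows "feasible e P (\<lambda>x. \<exists>a\<in>set (l x). h x a)"
proof -
  have fold: "foldl (\<lambda>acc a. acc \<or> f a) acc xs \<longleftrightarrow> acc \<or> (\<exists>a\<in>set xs. f a)"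
    for f :: "'x \<Rightarrow> bool" and acc xs
    by (induction xs arbitrary: acc) auto
  have h': "feasible e (\<lambda>n B y. P n B (fst y) \<and> snd (snd y) \<in> set (l (fst y)))
      (\<lambda>y. h (fst y) (snd (snd y)))"
    using feasible_comp[OF feasible_Pair[OF feasible_fst[OF feasible_id]
          feasible_snd[OF feasible_snd[OF feasible_id]]] h] by simp
  have "feasible e P (\<lambda>x. foldl (\<lambda>acc a. acc \<or> h x a) False (l x))"
    by (intro feasible_foldl_short feasible_const feasible_disj h' feasible_fst
        feasible_snd feasible_id assms(1)) (rule l(2))
  then show ?thesis by (simp add: fold)
qed

lemma feasible_ball:
  assumes "feasible e P l" "\<And>n B x. P n B x \<Longrightarrow> length (l x) \<le> n"
    and "feasible e (\<lambda>n B y. P n B (fst y) \<and> snd y \<in> set (l (fst y))) (\<lambda>y. h (fst y) (snd y))"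
  shows "feasible e P (\<lambda>x. \<forall>a\<in>set (l x). h x a)"
  using feasible_not[OF feasible_bex[OF assms(1,2) feasible_not[OF assms(3)]]] by simp

lemma feasible_null:
  assumes "feasible e P l"
  shows "feasible e P (\<lambda>x. l x = [])"
proof -
  have "feasible e P (\<lambda>x. if l x = [] then True else False)"
    by (intro feasible_if_null feasible_const assms)
  moreover have "(\<lambda>x. if l x = [] then True else False) = (\<lambda>x. l x = [])" by auto
  ultimately show ?thesis by (simp only:)
qed

text \<open>The loop consumes the second list inside the accumulator, which is why only the first
  list needs a length bound.\<close>

lemma feasible_zip:
  assumes f: "feasible e P f" "\<And>n B x. P n B x \<Longrightarrow> length (f x) \<le> n" and g: "feasible e P g"
  shows "feasible e P (\<lambda>x. zip (f x) (g x))"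
proof -
  have fold: "snd (foldl (\<lambda>acc a. if fst acc = [] then acc
      else (tl (fst acc), (a, hd (fst acc)) # snd acc)) (ys, zs) xs) = rev (zip xs ys) @ zs"
    for ys :: "'y list" and zs and xs :: "'x list"
  proof (induction xs arbitrary: ys zs)
    case (Cons x xs)
    then show ?case by (cases ys) auto
  qed simp
  have "feasible e P (\<lambda>x. rev (snd (foldl (\<lambda>acc a. if fst acc = [] then acc
      else (tl (fst acc), (a, hd (fst acc)) # snd acc)) (g x, []) (f x))))"
    by (intro feasible_rev feasible_foldl_short feasible_if_null feasible_const feasible_Cons
        feasible_Pair feasible_tl feasible_hd feasible_fst feasible_snd feasible_id f(1) g)
      (auto simp: fold f(2) intro: le_trans[OF min.cobounded1])
  then show ?thesis by (simp add: fold)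
qed

section \<open>The listing algorithm on bit vectors\<close>

definition bor :: "bool list \<Rightarrow> bool list \<Rightarrow> bool list" where
  "bor xs ys = map (\<lambda>p. fst p \<or> snd p) (zip xs ys)"

definition band :: "bool list \<Rightarrow> bool list \<Rightarrow> bool list" where
  "band xs ys = map (\<lambda>p. fst p \<and> snd p) (zip xs ys)"

text \<open>The subtrahend comes first: all loops run over the first argument, whose length is known.\<close>

definition bminus :: "bool list \<Rightarrow> bool list \<Rightarrow> bool list" where
  "bminus xs ys = map (\<lambda>p. snd p \<and> \<not> fst p) (zip xs ys)"

definition meets :: "bool list \<Rightarrow> bool list \<Rightarrow> bool" where
  "meets xs ys \<longleftrightarrow> (\<exists>p\<in>set (zip xs ys). fst p \<and> snd p)"

fun first_bit :: "bool list \<Rightarrow> bool list" where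
  "first_bit [] = []"
| "first_bit (b # bs) = (if b then True # map (\<lambda>_. False) bs else False # first_bit bs)"

text \<open>The identity matrix: its rows encode the singletons, so a vertex is handled as a bit
  vector like every other set.\<close>

fun unit_rows :: "nat \<Rightarrow> bool list list" where
  "unit_rows 0 = []"
| "unit_rows (Suc n) = (True # replicate n False) # map (Cons False) (unit_rows n)"

text \<open>
  The square of the number of vertices bounds the number of edges, hence that many rounds
  suffice to reach everything.
\<close>

definition spread :: "bool list list \<Rightarrow> bool list \<Rightarrow> bool list \<Rightarrow> bool list" where
  "spread M X Y = foldl (\<lambda>Y r. foldl (\<lambda>Y b. bor (map (\<lambda>q. meets q (band X Y)) M) Y) Y r) Y M"

text \<open>\<open>spread\<close> continues only from bits of \<open>X\<close> but also marks their
  neighbours, so one search from the first vertex of \<open>X\<close> tests connectivity and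
  domination together.\<close>

definition is_cds :: "bool list list \<Rightarrow> bool list \<Rightarrow> bool" where
  "is_cds M X \<longleftrightarrow> (\<exists>b\<in>set X. b) \<and> (\<forall>b\<in>set (spread M X (first_bit X)). b)"

text \<open>\<open>fst p\<close> is a vertex as a singleton and \<open>snd p\<close> its
  neighbourhood. Taking the first vertex of each component of the graph induced by \<open>I\<close>
  makes the choice of representatives canonical.\<close>

definition reps :: "bool list list \<Rightarrow> bool list \<Rightarrow> bool list" where
  "reps M I = map (\<lambda>p. if meets (fst p) I then meets (fst p) (first_bit (band I (spread M I (fst p))))
     else \<not> meets (snd p) I) (zip (unit_rows (length M)) M)"

definition ones :: "bool list \<Rightarrow> unit list" where
  "ones xs = foldl (\<lambda>acc b. if b then () # acc else acc) [] xs"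

text \<open>Comparison in unary: every bit of \<open>zs\<close> removes two tokens, and
  \<open>tl\<close> stops at the empty list.\<close>

definition at_most_twice :: "bool list \<Rightarrow> bool list \<Rightarrow> bool" where
  "at_most_twice xs zs \<longleftrightarrow> foldl (\<lambda>acc b. if b then tl (tl acc) else acc) (ones xs) zs = []"

definition push ::
  "bool list list \<Rightarrow> bool list \<Rightarrow> bool list \<Rightarrow> bool list \<Rightarrow> bool list list \<Rightarrow> bool list list" where
  "push M I P X out =
     (if is_cds M (bor I X) \<and> at_most_twice (band P X) (reps M I) then X # out else out)"

text \<open>The state consists of the alive sets and the decided vertices. An undecided
  \<open>v\<close> of \<open>L\<close> lies in all alive sets, so keeping \<open>X\<close> and
  removing \<open>v\<close> from it are the two choices.\<close>

definition branch :: "bool list list \<Rightarrow> bool list \<Rightarrow> bool list \<Rightarrow>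
    bool list list \<times> bool list \<Rightarrow> bool list \<Rightarrow> bool list list \<times> bool list" where
  "branch M I L acc v = (if meets v L then
     (foldl (\<lambda>out X. push M I (bor v (snd acc)) (bminus v X) (push M I (bor v (snd acc)) X out))
        [] (fst acc),
      bor v (snd acc)) else acc)"

definition is_minimal :: "bool list list \<Rightarrow> bool list \<Rightarrow> bool list \<Rightarrow> bool" where
  "is_minimal M I X \<longleftrightarrow> is_cds M (bor I X) \<and>
     (\<forall>v\<in>set (unit_rows (length M)). meets v X \<longrightarrow> \<not> is_cds M (bor I (bminus v X)))"

definition search :: "bool list list \<Rightarrow> bool list \<Rightarrow> bool list \<Rightarrow> bool list list \<Rightarrow> bool list list" where
  "search M I L vs = fst (foldl (branch M I L) ([L], map (\<lambda>_. False) L) vs)"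

definition list_minimal :: "bool list list \<Rightarrow> bool list \<Rightarrow> bool list \<Rightarrow> bool list list" where
  "list_minimal M I L =
     foldl (\<lambda>out X. if is_minimal M I X then X # out else out) []
       (search M I L (unit_rows (length M)))"

section \<open>Feasibility of the bit vector operations and of the algorithm\<close>

lemma length_bor: "length (bor xs ys) \<le> length xs"
  and length_band: "length (band xs ys) \<le> length xs"
  by (simp_all add: bor_def band_def)

lemma length_first_bit [simp]: "length (first_bit xs) = length xs"
  by (induction xs) auto

lemma length_unit_rows [simp]: "length (unit_rows n) = n"
  by (induction n) auto

lemma length_in_unit_rows: "v \<in> set (unit_rows n) \<Longrightarrow> length v = n"
  by (induction n arbitrary: v) auto

lemma in_zip_unit_rows: "(v, r) \<in> set (zip (unit_rows n) M) \<Longrightarrow> length v = n \<and> r \<in> set M"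
  by (auto dest: set_zip_leftD set_zip_rightD length_in_unit_rows)

lemmas feasible_basic = feasible_id feasible_const feasible_fst feasible_snd feasible_Pair
  feasible_Cons feasible_tl feasible_not feasible_conj feasible_disj feasible_imp

lemma feasible_bor:
  assumes "feasible e P f" "\<And>n B x. P n B x \<Longrightarrow> length (f x) \<le> n" "feasible e P g"
  shows "feasible e P (\<lambda>x. bor (f x) (g x))"
  unfolding bor_def
  by (intro feasible_map feasible_zip feasible_basic assms)
    (auto intro: le_trans[OF min.cobounded1] assms(2))

lemma feasible_band:
  assumes "feasible e P f" "\<And>n B x. P n B x \<Longrightarrow> length (f x) \<le> n" "feasible e P g"
  shows "feasible e P (\<lambda>x. band (f x) (g x))"
  unfolding band_def
  by (intro feasible_map feasible_zip feasible_basic assms)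
    (auto intro: le_trans[OF min.cobounded1] assms(2))

lemma feasible_bminus:
  assumes "feasible e P f" "\<And>n B x. P n B x \<Longrightarrow> length (f x) \<le> n" "feasible e P g"
  shows "feasible e P (\<lambda>x. bminus (f x) (g x))"
  unfolding bminus_def
  by (intro feasible_map feasible_zip feasible_basic assms)
    (auto intro: le_trans[OF min.cobounded1] assms(2))

lemma feasible_meets:
  assumes "feasible e P f" "\<And>n B x. P n B x \<Longrightarrow> length (f x) \<le> n" "feasible e P g"
  shows "feasible e P (\<lambda>x. meets (f x) (g x))"
  unfolding meets_def
  by (intro feasible_bex feasible_zip feasible_basic assms)
    (auto intro: le_trans[OF min.cobounded1] assms(2))

lemma feasible_first_bit:
  assumes "feasible e P f" "\<And>n B x. P n B x \<Longrightarrow> length (f x) \<le> n"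
  shows "feasible e P (\<lambda>x. first_bit (f x))"
proof -
  let ?h = "\<lambda>acc b. (fst acc \<or> b, (b \<and> \<not> fst acc) # snd acc)"
  have seen: "snd (foldl ?h (True, zs) xs) = map (\<lambda>_. False) xs @ zs" for xs zs
    by (induction xs arbitrary: zs) (auto simp: replicate_append_same map_replicate_const)
  have fold: "rev (snd (foldl ?h (False, zs) xs)) = rev zs @ first_bit xs" for xs zs
    by (induction xs arbitrary: zs) (auto simp: seen map_replicate_const)
  have len: "length (snd (foldl ?h (False, []) xs)) = length xs" for xs
    using arg_cong[OF fold[of "[]" xs], of length] by simp
  have "feasible e P (\<lambda>x. rev (snd (foldl ?h (False, []) (f x))))"
    by (intro feasible_rev feasible_foldl_short feasible_basic assms(1)) (auto simp: len assms(2))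
  then show ?thesis by (simp add: fold)
qed

lemma feasible_unit_rows:
  assumes M: "feasible e P M" "\<And>n B x. P n B x \<Longrightarrow> length (M x) \<le> n"
  shows "feasible e P (\<lambda>x. unit_rows (length (M x)))"
proof -
  let ?h = "\<lambda>acc b. ((True # snd acc) # map (Cons False) (fst acc), False # snd acc)"
  have fold: "foldl ?h ([], []) xs = (unit_rows (length xs), replicate (length xs) False)"
    for xs :: "'x list"
    by (induction xs rule: rev_induct) auto
  \<comment> \<open>The body maps over the accumulator, whose length has to be bounded through the
    partial results; hence the general fold rule with \<open>Q\<close>.\<close>
  have "feasible (e + 0) P (\<lambda>x. foldl ?h ([], []) (M x))"
  proof (rule feasible_foldl[where k = 1 and Q = "\<lambda>n B y. length (fst (fst (snd y))) \<le> n"])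
    show "feasible e (\<lambda>n B y. length (fst (fst (snd y))) \<le> n)
      (\<lambda>y. ((True # snd (fst (snd y))) # map (Cons False) (fst (fst (snd y))),
        False # snd (fst (snd y))))"
      by (intro feasible_map feasible_basic) auto
    show "length (fst (fst (snd (x, foldl ?h ([], []) (take j (M x)), M x ! j)))) \<le> n"
      if "P n B x" "j < length (M x)" for n B x j
      using M(2)[OF that(1)] that(2) by (simp add: fold)
    show "length (M x) \<le> 1 * (n + 1) * (B + 1) ^ 0" if "P n B x" for n B x
      using M(2)[OF that] by simp
  qed (use M feasible_const in auto)
  from feasible_fst[OF this] show ?thesis by (simp add: fold)
qed

lemma feasible_spread:
  assumes "feasible e P M" "feasible e P X" "feasible e P Y"
    and M: "\<And>n B x. P n B x \<Longrightarrow> length (M x) \<le> n"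
    and rows: "\<And>n B x r. P n B x \<Longrightarrow> r \<in> set (M x) \<Longrightarrow> length r \<le> n"
    and X: "\<And>n B x. P n B x \<Longrightarrow> length (X x) \<le> n"
  shows "feasible e P (\<lambda>x. spread (M x) (X x) (Y x))"
proof -
  have up: "feasible e (\<lambda>n B y. R n B y) (\<lambda>y. f (g y))"
    if "feasible e P f" "feasible e R g" "\<And>n B y. R n B y \<Longrightarrow> P n B (g y)"
    for R :: "nat \<Rightarrow> nat \<Rightarrow> 'z::encodable \<Rightarrow> bool" and f :: "_ \<Rightarrow> 'w::encodable" and g
    using that by (intro feasible_comp[of e R g P f]) auto
  show ?thesis
    unfolding spread_def
    by (intro feasible_foldl_short feasible_bor feasible_map feasible_meets feasible_band
        assms(1-3) up[OF assms(1)] up[OF assms(2)] feasible_basic)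
      (auto simp: M X rows)
qed

text \<open>Carries a parameter of the outer input into a loop body, where that input is only a
  component of a tuple.\<close>

lemma feasible_lift:
  assumes "feasible e P f" "feasible e Q g" "\<And>n B y. Q n B y \<Longrightarrow> P n B (g y)"
  shows "feasible e Q (\<lambda>y. f (g y))"
  using assms by (intro feasible_comp[of e Q g P f]) auto

lemma feasible_is_cds:
  assumes "feasible e P M" "feasible e P X"
    and M: "\<And>n B x. P n B x \<Longrightarrow> length (M x) \<le> n"
    and rows: "\<And>n B x r. P n B x \<Longrightarrow> r \<in> set (M x) \<Longrightarrow> length r \<le> n"
    and X: "\<And>n B x. P n B x \<Longrightarrow> length (X x) \<le> n"
  shows "feasible e P (\<lambda>x. is_cds (M x) (X x))"
proof -
  \<comment> \<open>\<open>is_cds\<close> loops over the result of \<open>spread\<close>, so its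
    length matters; \<open>bor\<close> truncates to the shorter argument.\<close>
  have len: "length (spread M X Y) \<le> max (length M) (length Y)" for M X Y
  proof -
    have inner: "length (foldl (\<lambda>Y b. bor (map (\<lambda>q. meets q (band X Y)) M) Y) Y r)
        \<le> max (length M) (length Y)" for Y and r :: "bool list"
    proof (induction r arbitrary: Y)
      case (Cons b r)
      show ?case
        using Cons[of "bor (map (\<lambda>q. meets q (band X Y)) M) Y"]
          length_bor[of "map (\<lambda>q. meets q (band X Y)) M" Y] by simp
    qed simp
    have "length (foldl (\<lambda>Y r. foldl (\<lambda>Y b. bor (map (\<lambda>q. meets q (band X Y)) M) Y) Y r) Y N)
        \<le> max (length M) (length Y)" for N :: "bool list list"
    proof (induction N arbitrary: Y)
      case (Cons r N)
      show ?case
        using Cons[of "foldl (\<lambda>Y b. bor (map (\<lambda>q. meets q (band X Y)) M) Y) Y r"] inner[of Y r]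
        by simp
    qed simp
    then show ?thesis by (simp add: spread_def)
  qed
  show ?thesis
    unfolding is_cds_def
    by (intro feasible_conj feasible_bex feasible_ball feasible_spread feasible_first_bit
        feasible_snd feasible_id assms(1,2))
      (use len in \<open>auto simp: M X rows intro!: le_trans[OF len]\<close>)
qed

lemma feasible_reps:
  assumes "feasible e P M" "feasible e P I"
    and M: "\<And>n B x. P n B x \<Longrightarrow> length (M x) \<le> n"
    and rows: "\<And>n B x r. P n B x \<Longrightarrow> r \<in> set (M x) \<Longrightarrow> length r \<le> n"
    and I: "\<And>n B x. P n B x \<Longrightarrow> length (I x) \<le> n"
  shows "feasible e P (\<lambda>x. reps (M x) (I x))"
  unfolding reps_def
  by (intro feasible_map feasible_zip feasible_if feasible_meets feasible_first_bit feasible_band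
      feasible_spread feasible_unit_rows assms(1,2) feasible_lift[OF assms(1)]
      feasible_lift[OF assms(2)] feasible_basic)
    (auto simp: M I rows dest!: in_zip_unit_rows
      intro!: le_trans[OF length_band])

lemma feasible_at_most_twice:
  assumes "feasible e P f" "\<And>n B x. P n B x \<Longrightarrow> length (f x) \<le> n"
    and "feasible e P g" "\<And>n B x. P n B x \<Longrightarrow> length (g x) \<le> n"
  shows "feasible e P (\<lambda>x. at_most_twice (f x) (g x))"
  unfolding at_most_twice_def ones_def
  by (intro feasible_null feasible_foldl_short feasible_if assms feasible_basic)

lemma feasible_push:
  assumes "feasible e P M" "feasible e P I" "feasible e P A" "feasible e P X" "feasible e P out"
    and M: "\<And>n B x. P n B x \<Longrightarrow> length (M x) \<le> n"
    and rows: "\<And>n B x r. P n B x \<Longrightarrow> r \<in> set (M x) \<Longrightarrow> length r \<le> n"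
    and I: "\<And>n B x. P n B x \<Longrightarrow> length (I x) \<le> n"
    and A: "\<And>n B x. P n B x \<Longrightarrow> length (A x) \<le> n"
  shows "feasible e P (\<lambda>x. push (M x) (I x) (A x) (X x) (out x))"
proof -
  have test: "feasible e P (\<lambda>x. is_cds (M x) (bor (I x) (X x)) \<and>
      at_most_twice (band (A x) (X x)) (reps (M x) (I x)))"
    by (intro feasible_conj feasible_is_cds feasible_at_most_twice feasible_bor feasible_band
        feasible_reps assms(1-5))
      (auto simp: M I A rows reps_def intro!: le_trans[OF length_bor] le_trans[OF length_band]
        min.coboundedI2)
  show ?thesis
    unfolding push_def
    by (intro feasible_if test feasible_Cons feasible_mono[OF assms(4) _ order_refl]
        feasible_mono[OF assms(5) _ order_refl]) auto
qed

text \<open>A list of up to \<open>B + 1\<close> entries is traversed with a body of degree 0, which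
  yields degree 1. All loops over exponential lists are of this kind, and they are never
  nested.\<close>

lemma feasible_foldl_long:
  fixes h :: "'a::encodable \<Rightarrow> 'b::encodable \<Rightarrow> 'c::encodable \<Rightarrow> 'b"
  assumes "feasible 1 P l" "feasible 1 P i"
    and h: "feasible 0 (\<lambda>n B y. P n B (fst y)) (\<lambda>y. h (fst y) (fst (snd y)) (snd (snd y)))"
    and "\<And>n B x. P n B x \<Longrightarrow> length (l x) \<le> B + 1"
  shows "feasible 1 P (\<lambda>x. foldl (h x) (i x) (l x))"
proof -
  have len: "length (l x) \<le> 1 * (n + 1) * (B + 1) ^ 1" if "P n B x" for n B x
    using assms(4)[OF that] by (simp add: le_trans)
  have "feasible (0 + 1) P (\<lambda>x. foldl (h x) (i x) (l x))"
    by (rule feasible_foldl[OF _ _ h _ len]) (use assms(1,2) in auto)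
  then show ?thesis by simp
qed

lemma feasible_branch:
  assumes "feasible 0 P M" "feasible 0 P I" "feasible 0 P L" "feasible 0 P acc" "feasible 0 P v"
    and M: "\<And>n B x. P n B x \<Longrightarrow> length (M x) \<le> n"
    and rows: "\<And>n B x r. P n B x \<Longrightarrow> r \<in> set (M x) \<Longrightarrow> length r \<le> n"
    and I: "\<And>n B x. P n B x \<Longrightarrow> length (I x) \<le> n"
    and v: "\<And>n B x. P n B x \<Longrightarrow> length (v x) \<le> n"
    and acc: "\<And>n B x. P n B x \<Longrightarrow> length (fst (acc x)) \<le> B + 1"
  shows "feasible 1 P (\<lambda>x. branch (M x) (I x) (L x) (acc x) (v x))"
proof -
  have up: "feasible 1 P f" if "feasible 0 P f" for f :: "_ \<Rightarrow> 'z::encodable"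
    by (rule feasible_mono[OF that]) auto
  have "feasible 1 P (\<lambda>x. foldl (\<lambda>out X. push (M x) (I x) (bor (v x) (snd (acc x))) (bminus (v x) X)
      (push (M x) (I x) (bor (v x) (snd (acc x))) X out)) [] (fst (acc x)))"
    by (intro feasible_foldl_long feasible_push feasible_bor feasible_bminus
        up[OF assms(4)] feasible_lift[OF assms(1)] feasible_lift[OF assms(2)]
        feasible_lift[OF assms(4)] feasible_lift[OF assms(5)] feasible_basic)
      (auto simp: M I v rows acc[simplified] intro!: le_trans[OF length_bor])
  then have "feasible 1 P (\<lambda>x. (foldl (\<lambda>out X. push (M x) (I x) (bor (v x) (snd (acc x))) (bminus (v x) X)
      (push (M x) (I x) (bor (v x) (snd (acc x))) X out)) [] (fst (acc x)),
      bor (v x) (snd (acc x))))"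
    by (intro feasible_Pair feasible_bor feasible_snd up[OF assms(4)] up[OF assms(5)]) (auto simp: v)
  then show ?thesis
    unfolding branch_def
    by (intro feasible_if feasible_meets up[OF assms(3)] up[OF assms(5)] v)
      (auto intro: feasible_mono up assms(4))
qed

text \<open>\<open>B\<close> must bound the search list after every prefix of the vertices, since
  each round traverses the list left by the previous one. There are at most \<open>n\<close> rounds,
  so the degree stays 1.\<close>

lemma feasible_list_minimal:
  assumes "feasible 0 P M" "feasible 0 P I" "feasible 0 P L"
    and M: "\<And>n B x. P n B x \<Longrightarrow> length (M x) \<le> n"
    and rows: "\<And>n B x r. P n B x \<Longrightarrow> r \<in> set (M x) \<Longrightarrow> length r \<le> n"
    and I: "\<And>n B x. P n B x \<Longrightarrow> length (I x) \<le> n"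
    and L: "\<And>n B x. P n B x \<Longrightarrow> length (L x) \<le> n"
    and B: "\<And>n B x j. P n B x \<Longrightarrow>
      length (search (M x) (I x) (L x) (take j (unit_rows (length (M x))))) \<le> B + 1"
  shows "feasible 1 P (\<lambda>x. list_minimal (M x) (I x) (L x))"
proof -
  have up: "feasible 1 P f" if "feasible 0 P f" for f :: "_ \<Rightarrow> 'z::encodable"
    by (rule feasible_mono[OF that]) auto
  let ?i = "\<lambda>x. ([L x], map (\<lambda>_. False) (L x))"
  let ?vs = "\<lambda>x. unit_rows (length (M x))"
  define Q where "Q = (\<lambda>n B (y :: _ \<times> (bool list list \<times> bool list) \<times> bool list). P n B (fst y) \<and> length (fst (fst (snd y))) \<le> B + 1 \<and>
    length (snd (snd y)) \<le> n)"
  have "feasible (1 + 0) P (\<lambda>x. foldl (branch (M x) (I x) (L x)) (?i x) (?vs x))"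
  proof (rule feasible_foldl[where Q = Q and k = 1])
    show "feasible 1 Q (\<lambda>y. branch (M (fst y)) (I (fst y)) (L (fst y)) (fst (snd y)) (snd (snd y)))"
      by (intro feasible_branch feasible_lift[OF assms(1)] feasible_lift[OF assms(2)]
          feasible_lift[OF assms(3)] feasible_basic) (auto simp: Q_def M I rows)
    show "feasible (1 + 0) P ?vs" using up[OF feasible_unit_rows[OF assms(1) M]] by simp
    show "feasible (1 + 0) P ?i"
    proof -
      have "feasible 1 P ?i" by (intro up feasible_map feasible_basic assms(3) L)
      then show ?thesis by simp
    qed
    show "Q n B (x, foldl (branch (M x) (I x) (L x)) (?i x) (take j (?vs x)), ?vs x ! j)"
      if "P n B x" "j < length (?vs x)" for n B x j
      using that B[OF that(1), of j] M[OF that(1)] length_in_unit_rows[of "?vs x ! j" "length (M x)"]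
      by (simp add: Q_def search_def)
    show "length (?vs x) \<le> 1 * (n + 1) * (B + 1) ^ 0" if "P n B x" for n B x
      using M[OF that] by simp
  qed
  then have search: "feasible 1 P (\<lambda>x. search (M x) (I x) (L x) (?vs x))"
    unfolding search_def by (intro feasible_fst) simp
  have is_min: "feasible 0 (\<lambda>n B y. P n B (fst y)) (\<lambda>y. is_minimal (M (fst y)) (I (fst y)) (snd (snd y)))"
    unfolding is_minimal_def
    by (intro feasible_conj feasible_is_cds feasible_ball feasible_bor feasible_bminus feasible_meets
        feasible_unit_rows feasible_lift[OF assms(1)] feasible_lift[OF assms(2)] feasible_basic)
      (auto simp: M I rows dest: length_in_unit_rows intro!: le_trans[OF length_bor])
  show ?thesis
    unfolding list_minimal_def
  proof (intro feasible_foldl_long search feasible_const)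
    show "feasible 0 (\<lambda>n B y. P n B (fst y)) (\<lambda>y. if is_minimal (M (fst y)) (I (fst y)) (snd (snd y))
        then snd (snd y) # fst (snd y) else fst (snd y))"
      by (intro feasible_if is_min feasible_basic)
    show "length (search (M x) (I x) (L x) (?vs x)) \<le> B + 1" if "P n B x" for n B x
      using B[OF that, of "length (M x)"] by simp
  qed
qed

section \<open>Counting\<close>

lemma rtrancl_exit:
  assumes "(x, z) \<in> r\<^sup>*" "x \<in> A" "z \<notin> A"
  obtains a b where "a \<in> A" "b \<notin> A" "(a, b) \<in> r" "(b, z) \<in> r\<^sup>*"
  using assms
proof (induction arbitrary: thesis rule: converse_rtrancl_induct)
  case base
  then show ?case by blast
next
  case (step y w)
  then show ?case by (cases "w \<in> A") blast+
qed

text \<open>Choose a point of \<open>W\<close> in every \<open>Q a\<close>; disjointness makes the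
  choice injective.\<close>

lemma card_le_of_disjoint_meets:
  assumes "finite W" "\<And>a. a \<in> A \<Longrightarrow> Q a \<inter> W \<noteq> {}"
    and "\<And>a b. a \<in> A \<Longrightarrow> b \<in> A \<Longrightarrow> a \<noteq> b \<Longrightarrow> Q a \<inter> Q b = {}"
  shows "card A \<le> card W"
proof -
  have "\<forall>a\<in>A. \<exists>w. w \<in> Q a \<inter> W" using assms(2) by blast
  then obtain f where f: "\<forall>a\<in>A. f a \<in> Q a \<inter> W" by metis
  have "inj_on f A"
  proof (rule inj_onI, rule ccontr)
    fix a b assume ab: "a \<in> A" "b \<in> A" "f a = f b" "a \<noteq> b"
    then have "f a \<in> Q a \<inter> Q b" using f by force
    then show False using assms(3)[OF ab(1,2,4)] by blast
  qed
  then show ?thesis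
    using f assms(1) by (intro card_inj_on_le[of f]) auto
qed

text \<open>A hitting set splits into its trace on \<open>b w\<close>, which is nonempty and so
  misses one of the \<open>2 ^ card (b w)\<close> choices, and a hitting set for the other blocks
  inside \<open>L - b w\<close>. A block of at most \<open>t\<close> elements thus costs the factor
  \<open>1 - 1 / 2 ^ t\<close>.\<close>

lemma card_hitting_sets_le:
  fixes b :: "'i \<Rightarrow> 'a set"
  assumes "finite W" "finite L"
    and "\<And>z. z \<in> W \<Longrightarrow> b z \<subseteq> L \<and> card (b z) \<le> t"
    and "\<And>z z'. z \<in> W \<Longrightarrow> z' \<in> W \<Longrightarrow> z \<noteq> z' \<Longrightarrow> b z \<inter> b z' = {}"
  shows "real (card {X. X \<subseteq> L \<and> (\<forall>z\<in>W. X \<inter> b z \<noteq> {})}) \<le> 2 ^ card L * (1 - 1 / 2 ^ t) ^ card W"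
  using assms
proof (induction W arbitrary: L rule: finite_induct)
  case empty
  then show ?case by (simp add: card_Pow flip: Pow_def)
next
  case (insert w W)
  let ?F = "\<lambda>L W. {X. X \<subseteq> L \<and> (\<forall>z\<in>W. X \<inter> b z \<noteq> {})}"
  have bw: "b w \<subseteq> L" "card (b w) \<le> t" using insert.prems by auto
  have fb: "finite (b w)" using bw insert.prems(1) finite_subset by blast
  have fin: "finite (?F (L - b w) W)" using insert.prems(1) by simp
  have bz: "b z \<inter> b w = {}" if "z \<in> W" for z
    using insert.prems(3)[of z w] insert.hyps that by auto
  have IH: "real (card (?F (L - b w) W)) \<le> 2 ^ card (L - b w) * (1 - 1 / 2 ^ t) ^ card W"
  proof (rule insert.IH)
    show "b z \<subseteq> L - b w \<and> card (b z) \<le> t" if "z \<in> W" for z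
      using bz[OF that] insert.prems(2)[of z] that by blast
  qed (use insert.prems in auto)
  let ?g = "\<lambda>X. (X \<inter> b w, X - b w)"
  have "card (?F L (insert w W)) \<le> card ((Pow (b w) - {{}}) \<times> ?F (L - b w) W)"
  proof (rule card_inj_on_le[of ?g])
    show "inj_on ?g (?F L (insert w W))" by (rule inj_onI) blast
    show "?g ` ?F L (insert w W) \<subseteq> (Pow (b w) - {{}}) \<times> ?F (L - b w) W"
    proof
      fix Y assume "Y \<in> ?g ` ?F L (insert w W)"
      then obtain X where X: "X \<subseteq> L" "X \<inter> b w \<noteq> {}" "\<forall>z\<in>W. X \<inter> b z \<noteq> {}" and Y: "Y = ?g X"
        by blast
      have "\<forall>z\<in>W. (X - b w) \<inter> b z \<noteq> {}" using X(3) bz by blast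
      then show "Y \<in> (Pow (b w) - {{}}) \<times> ?F (L - b w) W" using X(1,2) unfolding Y by blast
    qed
    show "finite ((Pow (b w) - {{}}) \<times> ?F (L - b w) W)" using fb fin by simp
  qed
  also have "\<dots> = (2 ^ card (b w) - 1) * card (?F (L - b w) W)"
    using fb by (simp add: card_cartesian_product card_Diff_subset card_Pow)
  finally have "real (card (?F L (insert w W))) \<le> (2 ^ card (b w) - 1) * real (card (?F (L - b w) W))"
    by (simp add: of_nat_diff flip: of_nat_le_iff[where 'a = real])
  also have "\<dots> \<le> (2 ^ card (b w) * (1 - 1 / 2 ^ t)) * (2 ^ card (L - b w) * (1 - 1 / 2 ^ t) ^ card W)"
  proof (rule mult_mono[OF _ IH])
    have "(2::real) ^ card (b w) \<le> 2 ^ t" using bw(2) by (intro power_increasing) auto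
    then show "(2::real) ^ card (b w) - 1 \<le> 2 ^ card (b w) * (1 - 1 / 2 ^ t)"
      by (simp add: field_simps)
  qed auto
  also have "\<dots> = 2 ^ (card (b w) + card (L - b w)) * (1 - 1 / 2 ^ t) ^ card (insert w W)"
    using insert.hyps by (simp add: power_add)
  also have "card (b w) + card (L - b w) = card L"
    using bw(1) insert.prems(1) fb by (metis card_Diff_subset card_mono le_add_diff_inverse)
  finally show ?case .
qed

text \<open>Chernoff: with \<open>h = 1/100\<close>, each small set contributes at least 1 to the sum of
  \<open>exp (h * (49/100 * m - card A))\<close>.\<close>

lemma card_small_subsets_le:
  fixes L :: "'a set"
  assumes "finite L"
  shows "real (card {A. A \<subseteq> L \<and> 100 * card A \<le> 49 * card L})
    \<le> 2 ^ card L * exp (- (real (card L) / 20000))"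
proof -
  define m where "m = card L"
  \<comment> \<open>The exponent per element will be \<open>- h / 100 + h\<^sup>2 / 2\<close>, which
    is smallest at this value and then equals -1/20000.\<close>
  define h :: real where "h = 1 / 100"
  let ?S = "{A. A \<subseteq> L \<and> 100 * card A \<le> 49 * card L}"
  have sum_Pow: "(\<Sum>A\<in>Pow L. x ^ card A) = (1 + x) ^ card L" for x :: real
    using assms
  proof (induction L rule: finite_induct)
    case empty
    then show ?case by simp
  next
    case (insert a L)
    have "(\<Sum>A\<in>Pow (insert a L). x ^ card A) =
        (\<Sum>A\<in>Pow L. x ^ card A) + (\<Sum>A\<in>insert a ` Pow L. x ^ card A)"
      unfolding Pow_insert using insert.hyps by (intro sum.union_disjoint) auto
    also have "(\<Sum>A\<in>insert a ` Pow L. x ^ card A) = (\<Sum>A\<in>Pow L. x ^ card (insert a A))"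
      using insert.hyps by (intro sum.reindex_cong[of "insert a"]) (auto intro!: inj_onI)
    also have "\<dots> = (\<Sum>A\<in>Pow L. x * x ^ card A)"
    proof (rule sum.cong[OF refl])
      fix A assume "A \<in> Pow L"
      then have "finite A" "a \<notin> A" using insert.hyps finite_subset by auto
      then show "x ^ card (insert a A) = x * x ^ card A" by simp
    qed
    finally show ?case
      unfolding sum_distrib_left[symmetric] insert.IH using insert.hyps by (simp add: distrib_right)
  qed
  have "real (card ?S) = (\<Sum>A\<in>?S. 1)" by simp
  also have "\<dots> \<le> (\<Sum>A\<in>?S. exp (h * (49 / 100 * m)) * exp (- h) ^ card A)"
  proof (rule sum_mono)
    fix A assume "A \<in> ?S"
    then have "100 * real (card A) \<le> 49 * real m"
      unfolding m_def mem_Collect_eq by linarith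
    then have "0 \<le> h * (49 / 100 * m) + real (card A) * (- h)"
      by (simp add: h_def)
    then have "1 \<le> exp (h * (49 / 100 * m) + real (card A) * (- h))" by simp
    then show "1 \<le> exp (h * (49 / 100 * m)) * exp (- h) ^ card A"
      unfolding exp_add exp_of_nat_mult .
  qed
  also have "\<dots> \<le> (\<Sum>A\<in>Pow L. exp (h * (49 / 100 * m)) * exp (- h) ^ card A)"
    using assms by (intro sum_mono2) auto
  also have "\<dots> = exp (h * (49 / 100 * m)) * (1 + exp (- h)) ^ m"
    unfolding sum_distrib_left[symmetric] sum_Pow m_def ..
  also have "\<dots> \<le> exp (h * (49 / 100 * m)) * (2 * exp (- h / 2 + h\<^sup>2 / 2)) ^ m"
  proof -
    have "exp (- h) \<le> 1 / (1 + h)"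
    proof -
      have "1 + h \<le> exp h" by (rule exp_ge_add_one_self)
      then show ?thesis by (simp add: exp_minus h_def field_simps)
    qed
    also have "\<dots> \<le> 1 - h + h\<^sup>2" by (simp add: h_def power2_eq_square)
    finally have "1 + exp (- h) \<le> 2 * (1 + (- h / 2 + h\<^sup>2 / 2))" by simp
    also have "\<dots> \<le> 2 * exp (- h / 2 + h\<^sup>2 / 2)"
      by (intro mult_left_mono exp_ge_add_one_self) auto
    finally show ?thesis
      by (intro mult_left_mono power_mono) (auto intro: add_nonneg_nonneg)
  qed
  also have "\<dots> = 2 ^ m * exp (h * (49 / 100 * m) + m * (- h / 2 + h\<^sup>2 / 2))"
    unfolding power_mult_distrib exp_add exp_of_nat_mult by (simp only: mult_ac)
  also have "h * (49 / 100 * m) + m * (- h / 2 + h\<^sup>2 / 2) = - (real m / 20000)"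
    by (simp add: h_def power2_eq_square)
  finally show ?thesis by (simp add: m_def)
qed

text \<open>In a largest disjoint subfamily \<open>W\<close>, every block meets the union of the
  chosen ones. That union has at most \<open>t * card W\<close> points, each of which lies in at
  most \<open>l\<close> blocks.\<close>

lemma disjoint_subfamily:
  fixes b :: "'i \<Rightarrow> 'a set"
  assumes "finite A" and fin: "\<And>z. z \<in> A \<Longrightarrow> finite (b z)"
    and ne: "\<And>z. z \<in> A \<Longrightarrow> b z \<noteq> {}"
    and size: "\<And>z. z \<in> A \<Longrightarrow> card (b z) \<le> t"
    and deg: "\<And>x. card {z \<in> A. x \<in> b z} \<le> l"
  obtains W where "W \<subseteq> A" "card A \<le> l * t * card W"
    "\<And>z z'. z \<in> W \<Longrightarrow> z' \<in> W \<Longrightarrow> z \<noteq> z' \<Longrightarrow> b z \<inter> b z' = {}"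
proof -
  let ?P = "\<lambda>W. W \<subseteq> A \<and> (\<forall>z\<in>W. \<forall>z'\<in>W. z \<noteq> z' \<longrightarrow> b z \<inter> b z' = {})"
  have "\<exists>W. ?P W \<and> (\<forall>W'. ?P W' \<longrightarrow> card W' \<le> card W)"
    by (rule ex_has_greatest_nat[of _ "{}" _ "Suc (card A)"])
      (use \<open>finite A\<close> card_mono in \<open>auto simp: less_Suc_eq_le\<close>)
  then obtain W where W: "?P W" and max: "\<And>W'. ?P W' \<Longrightarrow> card W' \<le> card W" by blast
  have finW: "finite W" using W \<open>finite A\<close> finite_subset by blast
  define U where "U = (\<Union>z\<in>W. b z)"
  have finU: "finite U" using W fin finW unfolding U_def by blast
  have meets: "b z \<inter> U \<noteq> {}" if z: "z \<in> A" for z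
  proof (cases "z \<in> W")
    case True
    then show ?thesis using ne[OF z] by (auto simp: U_def)
  next
    case False
    show ?thesis
    proof
      assume "b z \<inter> U = {}"
      then have "\<forall>w\<in>W. b z \<inter> b w = {}" unfolding U_def by blast
      then have "b w \<inter> b z = {}" if "w \<in> W" for w using that by blast
      with W z \<open>\<forall>w\<in>W. b z \<inter> b w = {}\<close> have "?P (insert z W)" by auto
      from max[OF this] show False using False finW by simp
    qed
  qed
  have "A \<subseteq> (\<Union>x\<in>U. {z \<in> A. x \<in> b z})" using meets by blast
  then have "card A \<le> card (\<Union>x\<in>U. {z \<in> A. x \<in> b z})"
    using finU \<open>finite A\<close> by (intro card_mono) auto
  also have "\<dots> \<le> (\<Sum>x\<in>U. card {z \<in> A. x \<in> b z})" using finU by (rule card_UN_le)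
  also have "\<dots> \<le> card U * l"
    using sum_bounded_above[of U "\<lambda>x. card {z \<in> A. x \<in> b z}" l] deg by simp
  also have "\<dots> \<le> (card W * t) * l"
  proof (rule mult_right_mono)
    have "card U \<le> (\<Sum>z\<in>W. card (b z))" unfolding U_def using finW by (rule card_UN_le)
    also have "\<dots> \<le> card W * t"
      using sum_bounded_above[of W "\<lambda>z. card (b z)" t] size W by auto
    finally show "card U \<le> card W * t" .
  qed simp
  finally have "card A \<le> l * t * card W" by (simp only: mult_ac)
  then show thesis using W by (intro that[of W]) auto
qed

text \<open>20000 is the Chernoff rate; already \<open>l = 1\<close> gives 102400 on the right, so
  the claimed bound is the weaker one.\<close>

lemma rate_ge: "l \<ge> 1 \<Longrightarrow> 20000 \<le> (2::real) ^ (10 * l) * 100 * real l ^ 3" for l :: nat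
proof -
  assume l: "l \<ge> 1"
  have "(2::real) ^ 10 * 100 * 1 \<le> 2 ^ (10 * l) * 100 * real l ^ 3"
    using l by (intro mult_mono power_increasing one_le_power) auto
  then show ?thesis by simp
qed

text \<open>Each element contributes \<open>2 * exp (- c)\<close> with \<open>c\<close> at most
  1/20000, which is at least 1. This lets the bound absorb additive constants and single
  sets.\<close>

lemma bound_ge_one:
  "l \<ge> 1 \<Longrightarrow> 1 \<le> (2::real) ^ m * exp (- (real m / (2 ^ (10 * l) * 100 * real l ^ 3)))"
proof -
  assume l: "l \<ge> 1"
  let ?c = "1 / (2 ^ (10 * l) * 100 * real l ^ 3)"
  have "1 / (2 ^ (10 * l) * 100 * real l ^ 3) \<le> 1 / 20000"
    using rate_ge[OF l] by (intro divide_left_mono) auto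
  then have "1 \<le> 2 * (1 + - ?c)" by simp
  also have "\<dots> \<le> 2 * exp (- ?c)" by (intro mult_left_mono exp_ge_add_one_self) auto
  finally have "1 \<le> (2 * exp (- ?c)) ^ m" by (rule one_le_power)
  also have "\<dots> = 2 ^ m * exp (- (real m / (2 ^ (10 * l) * 100 * real l ^ 3)))"
    by (simp add: power_mult_distrib flip: exp_of_nat_mult)
  finally show ?thesis .
qed

section \<open>Connected domination as reachability, and representatives\<close>

locale finite_symmetric_neighborhood =
  fixes V :: "'a set" and nb :: "'a \<Rightarrow> 'a set"
  assumes finite_V: "finite V"
    and nb_V: "nb u \<subseteq> V"
    and nb_sym: "v \<in> nb u \<Longrightarrow> u \<in> nb v"
begin

text \<open>Arcs start in \<open>X\<close> but may end outside, so only the last vertex of a path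
  can leave \<open>X\<close>. Reaching all of \<open>V\<close> from a vertex of \<open>X\<close>
  therefore expresses connectivity and domination at once.\<close>

definition step :: "'a set \<Rightarrow> ('a \<times> 'a) set" where
  "step X = {(a, b). a \<in> X \<and> b \<in> nb a}"

definition cds :: "'a set \<Rightarrow> bool" where
  "cds X \<longleftrightarrow> X \<subseteq> V \<and> (\<exists>u\<in>X. V \<subseteq> (step X)\<^sup>* `` {u})"

lemma step_mono: "X \<subseteq> Y \<Longrightarrow> (step X)\<^sup>* \<subseteq> (step Y)\<^sup>*"
  by (intro rtrancl_mono) (auto simp: step_def)

text \<open>\<open>b\<close> becomes the first vertex of the reversed path and hence has to lie in
  \<open>X\<close>; the inner vertices do so anyway.\<close>

lemma rtrancl_step_sym: "(a, b) \<in> (step X)\<^sup>* \<Longrightarrow> b \<in> X \<Longrightarrow> (b, a) \<in> (step X)\<^sup>*"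
proof (induction rule: rtrancl_induct)
  case base
  then show ?case by blast
next
  case (step y z)
  then have "y \<in> X" "(z, y) \<in> local.step X" using nb_sym by (auto simp: step_def)
  then show ?case using step.IH by (blast intro: converse_rtrancl_into_rtrancl)
qed

lemma cds_reach: "cds X \<Longrightarrow> u \<in> X \<Longrightarrow> v \<in> V \<Longrightarrow> (u, v) \<in> (step X)\<^sup>*"
proof -
  assume "cds X" and u: "u \<in> X" and v: "v \<in> V"
  then obtain w where w: "X \<subseteq> V" "V \<subseteq> (step X)\<^sup>* `` {w}" unfolding cds_def by blast
  then have "(w, u) \<in> (step X)\<^sup>*" "(w, v) \<in> (step X)\<^sup>*" using u v by blast+
  then show "(u, v) \<in> (step X)\<^sup>*" using rtrancl_step_sym[OF _ u] by (blast intro: rtrancl_trans)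
qed

lemma cds_mono: "cds X \<Longrightarrow> X \<subseteq> Y \<Longrightarrow> Y \<subseteq> V \<Longrightarrow> cds Y"
  unfolding cds_def using step_mono[of X Y] by blast

text \<open>Kept as a property instead of a construction: the count works for any choice, and the
  algorithm supplies one by list order. Between vertices of \<open>I\<close>, reachability by
  \<open>step I\<close> means lying in the same component of the graph induced by
  \<open>I\<close>.\<close>

definition representatives :: "'a set \<Rightarrow> 'a set \<Rightarrow> bool" where
  "representatives I Z \<longleftrightarrow> Z \<subseteq> V \<and> Z - I = {v \<in> V - I. nb v \<inter> I = {}} \<and>
     (\<forall>x\<in>I. \<exists>!z. z \<in> Z \<inter> I \<and> (z, x) \<in> (step I)\<^sup>*)"

lemma representatives_subset: "representatives I Z \<Longrightarrow> Z \<subseteq> V"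
  by (simp add: representatives_def)

lemma representatives_finite: "representatives I Z \<Longrightarrow> finite Z"
  using representatives_subset finite_V finite_subset by blast

lemma representatives_obtain:
  assumes "representatives I Z" "x \<in> I"
  obtains z where "z \<in> Z" "z \<in> I" "(z, x) \<in> (step I)\<^sup>*"
  using assms unfolding representatives_def by blast

lemma representatives_undominated:
  assumes "representatives I Z" "v \<in> V" "v \<notin> I" "nb v \<inter> I = {}"
  shows "v \<in> Z"
proof -
  have "v \<in> Z - I" using assms by (simp add: representatives_def)
  then show ?thesis by simp
qed

text \<open>
  Greedy choice: as long as some representative is not reached, one or two further vertices of
  the extension reach a new one; the chosen vertices already form an extension.
\<close>

lemma card_minimal_extension_le:
  assumes Z: "representatives I Z" and I: "I \<subseteq> V" and S: "S \<subseteq> V"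
    and cds: "cds (I \<union> S)" and minimal: "\<And>T. T \<subset> S \<Longrightarrow> \<not> cds (I \<union> T)"
  shows "card S \<le> 2 * card Z"
proof (cases "I = {}")
  case True
  then have "Z = V" using Z by (auto simp: representatives_def)
  then show ?thesis using card_mono[OF finite_V S] by simp
next
  case False
  then obtain u0 where u0: "u0 \<in> I" by blast
  have finZ: "finite Z" using Z by (rule representatives_finite)
  have finS: "finite S" using S finite_V finite_subset by auto
  define reach where "reach T = (step (I \<union> T))\<^sup>* `` {u0}" for T
  have reach_mono: "reach T \<subseteq> reach T'" if "T \<subseteq> T'" for T T'
    using step_mono[of "I \<union> T" "I \<union> T'"] that unfolding reach_def by blast
  have reach_step: "b \<in> reach T" if "a \<in> reach T" "a \<in> I \<union> T" "b \<in> nb a" for a b T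
    using that unfolding reach_def step_def by (auto intro: rtrancl_into_rtrancl)
  have reach_I: "b \<in> reach T" if "a \<in> reach T" "(a, b) \<in> (step I)\<^sup>*" for a b T
    using that step_mono[of I "I \<union> T"] unfolding reach_def by (auto intro: rtrancl_trans)
  \<comment> \<open>The greedy process as an extremal choice: \<open>T\<close> pays at most two
    vertices per reached representative and reaches as many as possible.\<close>
  let ?P = "\<lambda>T. T \<subseteq> S \<and> card T \<le> 2 * card (Z \<inter> reach T)"
  have "\<exists>T. ?P T \<and> (\<forall>T'. ?P T' \<longrightarrow> card (Z \<inter> reach T') \<le> card (Z \<inter> reach T))"
    by (rule ex_has_greatest_nat[of _ "{}" _ "Suc (card Z)"])
      (use finZ in \<open>auto simp: less_Suc_eq_le intro!: card_mono\<close>)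
  then obtain T where T: "?P T"
    and max: "\<And>T'. ?P T' \<Longrightarrow> card (Z \<inter> reach T') \<le> card (Z \<inter> reach T)" by blast
  have finT: "finite T" using T finS finite_subset by blast
  \<comment> \<open>Reaching one more representative with at most two more vertices would keep
    \<open>?P\<close> and contradict maximality.\<close>
  have gain: "z \<in> reach T"
    if T': "T \<subseteq> T'" "T' \<subseteq> S" "card T' \<le> card T + 2" and z: "z \<in> Z" "z \<in> reach T'" for T' z
  proof (rule ccontr)
    assume "z \<notin> reach T"
    then have "Z \<inter> reach T \<subset> Z \<inter> reach T'" using reach_mono[OF T'(1)] z by blast
    then have less: "card (Z \<inter> reach T) < card (Z \<inter> reach T')"
      using finZ by (intro psubset_card_mono) auto
    then have "?P T'" using T T' by auto
    from max[OF this] less show False by simp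
  qed
  have gain_I: "w \<in> reach T"
    if T': "T \<subseteq> T'" "T' \<subseteq> S" "card T' \<le> card T + 2" and w: "w \<in> I" "w \<in> reach T'" for T' w
  proof -
    obtain z where z: "z \<in> Z" "z \<in> I" "(z, w) \<in> (step I)\<^sup>*"
      using Z w(1) by (rule representatives_obtain)
    have "z \<in> reach T'" using reach_I[OF w(2)] rtrancl_step_sym[OF z(3) w(1)] by blast
    then have "z \<in> reach T" using gain[OF T' z(1)] by blast
    then show ?thesis using reach_I z(3) by blast
  qed
  have "Z \<subseteq> reach T"
  proof (rule ccontr)
    assume "\<not> Z \<subseteq> reach T"
    then obtain z where z: "z \<in> Z" "z \<notin> reach T" by blast
    have "(u0, z) \<in> (step (I \<union> S))\<^sup>*"
      using cds_reach[OF cds] u0 z Z by (auto simp: representatives_def)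
    moreover have "u0 \<in> reach T" by (simp add: reach_def)
    \<comment> \<open>Where a path to the missed \<open>z\<close> leaves the reached set,
      \<open>a\<close> must be a vertex of \<open>S\<close> outside \<open>T\<close>. Adding
      \<open>a\<close> alone reaches \<open>b\<close>, so by maximality \<open>b\<close> is neither
      in \<open>I\<close> nor in \<open>Z\<close>, hence dominated by some \<open>w\<close> in
      \<open>I\<close>.\<close>
    ultimately obtain a b where ab: "a \<in> reach T" "b \<notin> reach T" "(a, b) \<in> step (I \<union> S)"
        "(b, z) \<in> (step (I \<union> S))\<^sup>*"
      using z(2) by (rule rtrancl_exit)
    then have a: "a \<in> S" "b \<in> nb a" "a \<notin> I" "a \<notin> T"
      using reach_step[of a T b] by (auto simp: step_def)
    have T1: "T \<subseteq> insert a T" "insert a T \<subseteq> S" "card (insert a T) \<le> card T + 2"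
      using T a finT by auto
    have b1: "b \<in> reach (insert a T)"
      using reach_step[of a "insert a T" b] reach_mono[OF T1(1)] ab a by blast
    have bI: "b \<notin> I" using gain_I[OF T1 _ b1] ab(2) by blast
    have "b \<notin> Z" using gain[OF T1 _ b1] ab(2) by blast
    moreover have "b \<in> V" using a(2) nb_V by blast
    ultimately obtain w where w: "w \<in> nb b" "w \<in> I"
      using bI representatives_undominated[OF Z] by blast
    \<comment> \<open>The path goes on from \<open>b\<close>, so \<open>b\<close> belongs to
      \<open>S\<close> and may be added as well. Then \<open>w\<close> is reached, hence by
      \<open>gain_I\<close> it was reached with \<open>T\<close> already, and with it its neighbour
      \<open>b\<close>.\<close>
    have "b \<noteq> z" using \<open>b \<notin> Z\<close> z by blast
    with ab(4) obtain y where "(b, y) \<in> step (I \<union> S)" by (meson converse_rtranclE)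
    then have bS: "b \<in> S" using bI by (auto simp: step_def)
    have "card (insert b (insert a T)) \<le> card T + 2" using finT by (simp add: card_insert_if)
    moreover have "T \<subseteq> insert b (insert a T)" "insert b (insert a T) \<subseteq> S" using T1(2) bS by blast+
    ultimately have T2: "T \<subseteq> insert b (insert a T)" "insert b (insert a T) \<subseteq> S"
        "card (insert b (insert a T)) \<le> card T + 2"
      by blast+
    have "b \<in> reach (insert b (insert a T))" using reach_mono[of "insert a T"] b1 by blast
    then have "w \<in> reach (insert b (insert a T))" using w reach_step by blast
    then have "w \<in> reach T" using gain_I[OF T2 w(2)] by blast
    then have "b \<in> reach T" using reach_step[of w T b] w nb_sym by blast
    then show False using ab(2) by blast
  qed
  have "V \<subseteq> reach T"
  proof
    fix v assume v: "v \<in> V"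
    have I_reach: "w \<in> reach T" if w: "w \<in> I" for w
    proof -
      obtain z where "z \<in> Z" "z \<in> I" "(z, w) \<in> (step I)\<^sup>*"
        using Z w by (rule representatives_obtain)
      then show ?thesis using \<open>Z \<subseteq> reach T\<close> reach_I by blast
    qed
    show "v \<in> reach T"
    proof (cases "v \<in> I \<or> nb v \<inter> I = {}")
      case True
      then show ?thesis using I_reach representatives_undominated[OF Z v] \<open>Z \<subseteq> reach T\<close> by blast
    next
      case False
      then obtain w where "w \<in> I" "v \<in> nb w" using nb_sym by blast
      then show ?thesis using I_reach reach_step by blast
    qed
  qed
  then have "cds (I \<union> T)"
    using I S T u0 unfolding cds_def reach_def by blast
  then have "T = S" using minimal T by blast
  then show ?thesis
    using T card_mono[OF finZ, of "Z \<inter> reach T"] by simp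
qed

definition part :: "'a set \<Rightarrow> 'a \<Rightarrow> 'a set" where
  "part I z = (if z \<in> I then I \<inter> (step I)\<^sup>* `` {z} else {z})"

definition block :: "'a set \<Rightarrow> 'a set \<Rightarrow> 'a \<Rightarrow> 'a set" where
  "block I L z = {x \<in> L. x \<in> part I z \<or> nb x \<inter> part I z \<noteq> {}}"

lemma part_disjoint:
  assumes "representatives I Z" "z \<in> Z" "z' \<in> Z" "z \<noteq> z'"
  shows "part I z \<inter> part I z' = {}"
  using assms unfolding part_def representatives_def by (auto split: if_splits)

text \<open>If \<open>X\<close> avoided the block of an undominated \<open>z\<close>, nothing could
  reach \<open>z\<close>. If it avoided the block of a component of the graph induced by
  \<open>I\<close>, paths from \<open>z\<close> could never use \<open>X\<close>, so
  \<open>I\<close> alone would reach all of \<open>V\<close>, against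
  \<open>not_cds\<close>.\<close>

lemma meets_block:
  assumes Z: "representatives I Z" and z: "z \<in> Z" and X: "X \<subseteq> L" "I \<inter> L = {}"
    and cds: "cds (I \<union> X)" and not_cds: "\<not> cds I"
  shows "X \<inter> block I L z \<noteq> {}"
proof
  assume disj: "X \<inter> block I L z = {}"
  have zV: "z \<in> V" using Z z by (auto simp: representatives_def)
  show False
  proof (cases "z \<in> I")
    case False
    then have zI: "nb z \<inter> I = {}" using Z z by (auto simp: representatives_def)
    obtain u where u: "u \<in> I \<union> X" "(u, z) \<in> (step (I \<union> X))\<^sup>*"
      using cds cds_reach[OF cds _ zV] unfolding cds_def by blast
    from u(2) show False
    proof (cases rule: rtranclE)
      case base
      then show ?thesis using u(1) False disj X by (auto simp: block_def part_def)
    next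
      case (step y)
      then have "y \<in> X" "z \<in> nb y" using zI nb_sym by (auto simp: step_def)
      then show ?thesis using False disj X by (auto simp: block_def part_def)
    qed
  next
    case True
    have "(z, v) \<in> (step I)\<^sup>*" if "(z, v) \<in> (step (I \<union> X))\<^sup>*" for v
      using that
    proof (induction rule: rtrancl_induct)
      case base
      then show ?case by blast
    next
      case (step y w)
      have "y \<notin> X"
      proof
        assume y: "y \<in> X"
        then have "y \<noteq> z" using X True by blast
        with step.IH obtain c where c: "(z, c) \<in> (local.step I)\<^sup>*" "(c, y) \<in> local.step I"
          by (metis rtranclE)
        then have "c \<in> part I z" "c \<in> nb y" using True nb_sym by (auto simp: part_def step_def)
        then show False using disj y X by (auto simp: block_def)
      qed
      then have "(y, w) \<in> local.step I" using step.hyps by (auto simp: step_def)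
      then show ?case using step.IH by (rule rtrancl_into_rtrancl[rotated])
    qed
    then have "V \<subseteq> (step I)\<^sup>* `` {z}" using cds_reach[OF cds, of z] True by blast
    then have "cds I" using cds True unfolding cds_def by blast
    then show False using not_cds by blast
  qed
qed


text \<open>In units of \<open>card L\<close>: of more than 49/200 representatives, at most 1/10
  have a part meeting \<open>H\<close> and at most 1/8 a block larger than \<open>8 * l\<close>, so
  more than 1/50 remain. Thinning them out to disjoint blocks costs a factor
  \<open>l * (8 * l)\<close>, and 50 times 8 is 400.\<close>

lemma disjoint_blocks:
  assumes Z: "representatives I Z" and I: "I \<subseteq> V" and V: "V = L \<union> H \<union> R"
    and deg: "\<And>v. v \<in> L \<Longrightarrow> card (nb v \<inter> (L \<union> R)) < l"
    and H: "10 * card H * l \<le> card L" and l: "l \<ge> 1"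
    and many: "49 * card L < 200 * card Z"
    and ne: "\<And>z. z \<in> Z \<Longrightarrow> block I L z \<noteq> {}"
  obtains W where "W \<subseteq> Z" "card L \<le> 400 * l\<^sup>2 * card W"
    "\<And>z. z \<in> W \<Longrightarrow> card (block I L z) \<le> 8 * l"
    "\<And>z z'. z \<in> W \<Longrightarrow> z' \<in> W \<Longrightarrow> z \<noteq> z' \<Longrightarrow> block I L z \<inter> block I L z' = {}"
proof -
  have fin: "finite Z" "finite H" "finite L" "finite R" "Z \<subseteq> V"
    using representatives_finite[OF Z] representatives_subset[OF Z] finite_V unfolding V by auto
  have finb: "finite (block I L z)" for z using fin by (simp add: block_def)
  define ZH where "ZH = {z \<in> Z. part I z \<inter> H \<noteq> {}}"
  have ZH: "card ZH \<le> card H"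
    using fin part_disjoint[OF Z] by (intro card_le_of_disjoint_meets[of _ _ "part I"]) (auto simp: ZH_def)
  define Z1 where "Z1 = Z - ZH"
  have finZ1: "finite Z1" using fin by (simp add: Z1_def)
  have part_sub: "part I z \<subseteq> L \<union> R" if "z \<in> Z1" for z
  proof -
    have "part I z \<subseteq> V" using that I fin(5) by (auto simp: part_def Z1_def)
    moreover have "part I z \<inter> H = {}" using that by (auto simp: Z1_def ZH_def)
    ultimately show ?thesis using V by blast
  qed
  \<comment> \<open>The parts are disjoint subsets of \<open>L \<union> R\<close> and all meet the
    closed neighbourhood of \<open>x\<close> there, which has at most \<open>l\<close>
    elements.\<close>
  have deg1: "card {z \<in> Z1. x \<in> block I L z} \<le> l" for x
  proof (cases "x \<in> L")
    case True
    let ?W = "insert x (nb x \<inter> (L \<union> R))"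
    have "card {z \<in> Z1. x \<in> block I L z} \<le> card ?W"
    proof (rule card_le_of_disjoint_meets[of _ _ "part I"])
      show "finite ?W" using fin by simp
      show "part I z \<inter> ?W \<noteq> {}" if "z \<in> {z \<in> Z1. x \<in> block I L z}" for z
        using that part_sub[of z] by (auto simp: block_def)
    qed (use part_disjoint[OF Z] in \<open>auto simp: Z1_def\<close>)
    also have "\<dots> \<le> l" using deg[OF True] fin by (simp add: card_insert_if)
    finally show ?thesis .
  next
    case False
    then show ?thesis by (simp add: block_def)
  qed
  \<comment> \<open>Double counting of incidences: the blocks have total size at most
    \<open>card L * l\<close>, so at most one eighth of \<open>card L\<close> of them can exceed
    \<open>8 * l\<close>.\<close>
  have "(\<Sum>z\<in>Z1. card (block I L z)) = (\<Sum>z\<in>Z1. card {x \<in> L. x \<in> block I L z})"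
    by (intro sum.cong arg_cong[of _ _ card]) (auto simp: block_def)
  also have "\<dots> = (\<Sum>x\<in>L. card {z \<in> Z1. x \<in> block I L z})"
    using finZ1 fin by (intro sum_multicount_gen) auto
  also have "\<dots> \<le> card L * l"
    using sum_bounded_above[of L "\<lambda>x. card {z \<in> Z1. x \<in> block I L z}" l] deg1 by simp
  finally have total: "(\<Sum>z\<in>Z1. card (block I L z)) \<le> card L * l" .
  define Zb where "Zb = {z \<in> Z1. card (block I L z) > 8 * l}"
  have "card Zb * (8 * l) \<le> (\<Sum>z\<in>Zb. card (block I L z))"
    using sum_bounded_below[of Zb "8 * l" "\<lambda>z. card (block I L z)"] by (simp add: Zb_def)
  also have "\<dots> \<le> (\<Sum>z\<in>Z1. card (block I L z))"
    using finZ1 by (intro sum_mono2) (auto simp: Zb_def)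
  also note total
  finally have "(card Zb * 8) * l \<le> card L * l" by (simp only: mult.assoc)
  then have Zb: "card Zb * 8 \<le> card L" using l by simp
  define Zl where "Zl = Z1 - Zb"
  have finZl: "finite Zl" using finZ1 by (simp add: Zl_def)
  obtain W where W: "W \<subseteq> Zl" "card Zl \<le> l * (8 * l) * card W"
    "\<And>z z'. z \<in> W \<Longrightarrow> z' \<in> W \<Longrightarrow> z \<noteq> z' \<Longrightarrow> block I L z \<inter> block I L z' = {}"
  proof (rule disjoint_subfamily[OF finZl, of "block I L" "8 * l" l])
    show "card {z \<in> Zl. x \<in> block I L z} \<le> l" for x
      by (rule le_trans[OF card_mono deg1[of x]]) (use finZ1 in \<open>auto simp: Zl_def\<close>)
    show "finite (block I L z)" for z by (rule finb)
    show "block I L z \<noteq> {}" if "z \<in> Zl" for z using that by (intro ne) (simp add: Zl_def Z1_def)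
    show "card (block I L z) \<le> 8 * l" if "z \<in> Zl" for z
      using that by (auto simp: Zl_def Zb_def)
  qed (rule that)
  have "card Z = card (ZH \<union> Zb \<union> Zl)"
    by (rule arg_cong[of _ _ card]) (auto simp: Zl_def Zb_def Z1_def ZH_def)
  also have "\<dots> \<le> card ZH + card Zb + card Zl"
    using card_Un_le[of "ZH \<union> Zb" Zl] card_Un_le[of ZH Zb] by linarith
  finally have "card Z \<le> card ZH + card Zb + card Zl" .
  moreover have "10 * card H \<le> 10 * card H * l" using l by simp
  ultimately have "card L \<le> 50 * card Zl" using ZH Zb many H by linarith
  also have "\<dots> \<le> 50 * (l * (8 * l) * card W)" using W(2) by (rule mult_le_mono2)
  also have "\<dots> = 400 * l\<^sup>2 * card W" by (simp add: power2_eq_square)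
  finally have L: "card L \<le> 400 * l\<^sup>2 * card W" .
  have size: "card (block I L z) \<le> 8 * l" if "z \<in> W" for z
    using that W(1) by (auto simp: Zl_def Zb_def not_less)
  have "W \<subseteq> Z" using W(1) by (auto simp: Zl_def Z1_def)
  from that[OF this L size W(3)] show thesis by blast
qed

text \<open>The sets that can be alive once the vertices of \<open>P\<close> are decided: all
  undecided vertices are still present. \<open>P = L\<close> covers the minimal extensions
  themselves.\<close>

definition candidates :: "'a set \<Rightarrow> 'a set \<Rightarrow> 'a set \<Rightarrow> 'a set \<Rightarrow> 'a set set" where
  "candidates I Z L P = {X. X \<subseteq> L \<and> L - P \<subseteq> X \<and> cds (I \<union> X) \<and> card (X \<inter> P) \<le> 2 * card Z}"

lemma finite_candidates: "finite L \<Longrightarrow> finite (candidates I Z L P)"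
  by (rule finite_subset[of _ "Pow L"]) (auto simp: candidates_def)

text \<open>\<open>X\<close> contains all of \<open>L - P\<close> and is recovered from
  \<open>X \<inter> P\<close>, a set of at most \<open>2 * card Z\<close> elements, hence at most
  49/100 of \<open>card L\<close>.\<close>

lemma card_candidates_le_few:
  assumes "finite L" "l \<ge> 1" and few: "200 * card Z \<le> 49 * card L"
  shows "real (card (candidates I Z L P))
    \<le> 2 ^ card L * exp (- (real (card L) / (2 ^ (10 * l) * 100 * real l ^ 3)))"
proof -
  have "card (candidates I Z L P) \<le> card {A. A \<subseteq> L \<and> 100 * card A \<le> 49 * card L}"
  proof (rule card_inj_on_le[of "\<lambda>X. X \<inter> P"])
    show "inj_on (\<lambda>X. X \<inter> P) (candidates I Z L P)"
      by (rule inj_onI) (auto simp: candidates_def)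
    show "(\<lambda>X. X \<inter> P) ` candidates I Z L P \<subseteq> {A. A \<subseteq> L \<and> 100 * card A \<le> 49 * card L}"
      using few by (auto simp: candidates_def)
  qed (use assms in auto)
  also have "real \<dots> \<le> 2 ^ card L * exp (- (real (card L) / 20000))"
    using assms(1) by (rule card_small_subsets_le)
  also have "\<dots> \<le> 2 ^ card L * exp (- (real (card L) / (2 ^ (10 * l) * 100 * real l ^ 3)))"
  proof -
    have "real (card L) / (2 ^ (10 * l) * 100 * real l ^ 3) \<le> real (card L) / 20000"
      using rate_ge[OF assms(2)] by (intro divide_left_mono) auto
    then show ?thesis by (intro mult_left_mono) auto
  qed
  finally show ?thesis by simp
qed

lemma card_candidates_le:
  assumes Z: "representatives I Z" and I: "I \<subseteq> V" "I \<inter> L = {}" and V: "V = L \<union> H \<union> R"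
    and deg: "\<And>v. v \<in> L \<Longrightarrow> card (nb v \<inter> (L \<union> R)) < l"
    and H: "10 * card H * l \<le> card L" and l: "l \<ge> 1" and not_cds: "\<not> cds I"
  shows "real (card (candidates I Z L P))
    \<le> 2 ^ card L * exp (- (real (card L) / (2 ^ (10 * l) * 100 * real l ^ 3)))"
proof (cases "200 * card Z \<le> 49 * card L")
  case True
  have "finite L" using V finite_V by simp
  then show ?thesis using l True by (rule card_candidates_le_few)
next
  case False
  have hit: "X \<inter> block I L z \<noteq> {}" if "X \<in> candidates I Z L P" "z \<in> Z" for X z
    using meets_block[OF Z that(2), of X L] that(1) I(2) not_cds by (auto simp: candidates_def)
  show ?thesis
  proof (cases "\<exists>z\<in>Z. block I L z = {}")
    case True
    then have "candidates I Z L P = {}" using hit by blast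
    then show ?thesis by simp
  next
    case ne: False
    obtain W where W: "W \<subseteq> Z" "card L \<le> 400 * l\<^sup>2 * card W"
      "\<And>z. z \<in> W \<Longrightarrow> card (block I L z) \<le> 8 * l"
      "\<And>z z'. z \<in> W \<Longrightarrow> z' \<in> W \<Longrightarrow> z \<noteq> z' \<Longrightarrow> block I L z \<inter> block I L z' = {}"
      using disjoint_blocks[OF Z I(1) V deg H l] False ne by (metis not_le)
    have finL: "finite L" using V finite_V by simp
    have finW: "finite W" using W(1) representatives_finite[OF Z] finite_subset by blast
    let ?q = "1 / 2 ^ (8 * l) :: real"
    have "card (candidates I Z L P) \<le> card {X. X \<subseteq> L \<and> (\<forall>z\<in>W. X \<inter> block I L z \<noteq> {})}"
      using finL hit W(1) by (intro card_mono) (auto simp: candidates_def)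
    also have "real \<dots> \<le> 2 ^ card L * (1 - ?q) ^ card W"
      using W(3,4) finW finL by (intro card_hitting_sets_le) (auto simp: block_def)
    also have "\<dots> \<le> 2 ^ card L * exp (- ?q) ^ card W"
    proof (intro mult_left_mono power_mono)
      show "1 - ?q \<le> exp (- ?q)" using exp_ge_add_one_self[of "- ?q"] by simp
    qed auto
    also have "exp (- ?q) ^ card W = exp (- (card W * ?q))"
      by (simp add: exp_of_nat_mult[symmetric])
    also have "2 ^ card L * \<dots>
      \<le> 2 ^ card L * exp (- (real (card L) / (2 ^ (10 * l) * 100 * real l ^ 3)))"
    proof -
      \<comment> \<open>Closes the gap between the rate \<open>400 * l\<^sup>2 * 2 ^ (8 * l)\<close>
        given by the blocks and the claimed one: \<open>2 ^ (2 * l)\<close> and one \<open>l\<close>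
        pay for the factor 4.\<close>
      have l4: "4 \<le> real l * 2 ^ (2 * l)"
      proof -
        have "1 * (2::real) ^ 2 \<le> real l * 2 ^ (2 * l)"
          using l by (intro mult_mono power_increasing) auto
        then show ?thesis by simp
      qed
      have "real (card L) \<le> real (400 * l\<^sup>2 * card W)" using W(2) by (simp only: of_nat_le_iff)
      then have "real (card L) \<le> 100 * real l ^ 2 * (4 * real (card W))" by simp
      also have "\<dots> \<le> 100 * real l ^ 2 * (real l * 2 ^ (2 * l) * card W)"
        by (rule mult_left_mono[OF mult_right_mono[OF l4]]) auto
      also have "\<dots> = (2 ^ (10 * l) * 100 * real l ^ 3) * (card W * ?q)"
      proof -
        have "(2::real) ^ (10 * l) = 2 ^ (2 * l) * 2 ^ (8 * l)" by (simp flip: power_add)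
        then show ?thesis by (simp add: power2_eq_square power3_eq_cube)
      qed
      finally have "real (card L) / (2 ^ (10 * l) * 100 * real l ^ 3) \<le> card W * ?q"
        using l by (simp add: divide_le_eq mult.commute)
      then show ?thesis by (intro mult_left_mono) auto
    qed
    finally show ?thesis by simp
  qed
qed

text \<open>A connected \<open>I\<close> has a single component, and a dominating one leaves no
  vertex undominated. This replaces the block argument when \<open>I\<close> itself is connected
  dominating.\<close>

lemma card_representatives_cds:
  assumes Z: "representatives I Z" and cds: "cds I"
  shows "card Z \<le> 1"
proof -
  have ZI: "z \<in> I" if "z \<in> Z" for z
  proof (rule ccontr)
    assume zI: "z \<notin> I"
    then have "z \<in> Z - I" using that by blast
    then have z: "z \<in> V" "nb z \<inter> I = {}" using Z by (auto simp: representatives_def)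
    obtain u where u: "u \<in> I" "(u, z) \<in> (step I)\<^sup>*"
      using cds cds_reach[OF cds _ z(1)] unfolding cds_def by blast
    with zI obtain y where "(y, z) \<in> step I" by (metis rtranclE)
    then show False using z(2) nb_sym by (auto simp: step_def)
  qed
  have "z = z'" if "z \<in> Z" "z' \<in> Z" for z z'
  proof -
    have "(z, z') \<in> (step I)\<^sup>*"
      using cds_reach[OF cds] ZI that Z by (auto simp: representatives_def)
    moreover have "\<exists>!z. z \<in> Z \<inter> I \<and> (z, z') \<in> (step I)\<^sup>*"
      using Z ZI that unfolding representatives_def by blast
    ultimately show ?thesis using ZI that by blast
  qed
  moreover have "finite Z" using Z by (rule representatives_finite)
  ultimately show ?thesis by (simp add: card_le_Suc0_iff_eq)
qed

text \<open>From five vertices in \<open>L\<close> on, a single representative is within the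
  Chernoff threshold, as 200 is less than 49 times 5. Below that, \<open>L\<close> has at most 16
  subsets.\<close>

lemma card_candidates_le_cds:
  assumes Z: "representatives I Z" and L: "finite L" and l: "l \<ge> 1" and cds: "cds I"
  shows "real (card (candidates I Z L P))
    \<le> 16 * (2 ^ card L * exp (- (real (card L) / (2 ^ (10 * l) * 100 * real l ^ 3))))"
proof (cases "card L \<le> 4")
  case True
  have "card (candidates I Z L P) \<le> card (Pow L)"
    using L by (intro card_mono) (auto simp: candidates_def)
  also have "\<dots> \<le> 2 ^ 4" unfolding card_Pow[OF L] using True by (intro power_increasing) auto
  finally have "real (card (candidates I Z L P)) \<le> 16" by simp
  then show ?thesis using bound_ge_one[OF l, of "card L"] by linarith
next
  case False
  have "200 * card Z \<le> 49 * card L"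
    using card_representatives_cds[OF Z cds] False by linarith
  from card_candidates_le_few[OF L l this, of I P] show ?thesis
    using bound_ge_one[OF l, of "card L"] by linarith
qed

end

section \<open>Correctness of the algorithm\<close>

lemma first_bit_map:
  "distinct us \<Longrightarrow> first_bit (map (\<lambda>v. v \<in> S) us) =
     map (\<lambda>v. filter (\<lambda>v. v \<in> S) us \<noteq> [] \<and> v = hd (filter (\<lambda>v. v \<in> S) us)) us"
proof (induction us)
  case (Cons u us)
  show ?case
  proof (cases "u \<in> S")
    case True
    then show ?thesis using Cons.prems by auto
  next
    case False
    have "u \<noteq> hd (filter (\<lambda>v. v \<in> S) us)" if "filter (\<lambda>v. v \<in> S) us \<noteq> []"
      using hd_in_set[OF that] False by auto
    then show ?thesis using False Cons by auto
  qed
qed simp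

lemma unit_rows_map:
  "distinct us \<Longrightarrow> unit_rows (length us) = map (\<lambda>v. map (\<lambda>w. w \<in> {v}) us) us"
proof (induction us)
  case (Cons u us)
  have "map (\<lambda>w. w = u) us = replicate (length us) False"
    using Cons.prems by (intro replicate_eqI) auto
  then show ?case using Cons by auto
qed simp

lemma length_ones: "length (ones xs) = length (filter id xs)"
proof -
  have "length (foldl (\<lambda>acc b. if b then () # acc else acc) acc xs) = length acc + length (filter id xs)"
    for acc
    by (induction xs arbitrary: acc) auto
  then show ?thesis by (simp add: ones_def)
qed

lemma at_most_twice_iff:
  "at_most_twice xs zs \<longleftrightarrow> length (filter id xs) \<le> 2 * length (filter id zs)"
proof -
  have "foldl (\<lambda>acc b. if b then tl (tl acc) else acc) acc zs = drop (2 * length (filter id zs)) acc"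
    for acc :: "unit list"
    by (induction zs arbitrary: acc) (auto simp: drop_Suc)
  then show ?thesis by (simp add: at_most_twice_def length_ones)
qed

text \<open>The loops of \<open>spread\<close> use their lists only as round counters.\<close>

lemma foldl_funpow: "foldl (\<lambda>y _. f y) y xs = (f ^^ length xs) y"
  by (induction xs arbitrary: y) (auto simp: funpow_swap1)

lemma foldl_funpow_lengths: "foldl (\<lambda>y xs. (f ^^ length xs) y) y xss = (f ^^ sum_list (map length xss)) y"
proof (induction xss arbitrary: y)
  case (Cons xs xss)
  have "(f ^^ sum_list (map length xss)) ((f ^^ length xs) y) =
      (f ^^ (sum_list (map length xss) + length xs)) y"
    by (simp add: funpow_add)
  then show ?case using Cons by (simp add: add.commute)
qed simp

section \<open>Bit vectors as vertex sets\<close>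

locale listed_neighborhood = finite_symmetric_neighborhood +
  fixes vs :: "'a list"
  assumes distinct_vs: "distinct vs" and set_vs: "set vs = V"
begin

definition bits :: "'a set \<Rightarrow> bool list" where
  "bits S = map (\<lambda>v. v \<in> S) vs"

definition matrix :: "bool list list" where
  "matrix = map (\<lambda>v. bits (nb v)) vs"

definition first :: "'a set \<Rightarrow> 'a set" where
  "first S = (if filter (\<lambda>v. v \<in> S) vs = [] then {} else {hd (filter (\<lambda>v. v \<in> S) vs)})"

lemma length_bits [simp]: "length (bits S) = length vs"
  by (simp add: bits_def)

lemma length_matrix [simp]: "length matrix = length vs"
  by (simp add: matrix_def)

lemma bor_bits: "bor (bits A) (bits B) = bits (A \<union> B)"
  and band_bits: "band (bits A) (bits B) = bits (A \<inter> B)"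
  and bminus_bits: "bminus (bits A) (bits B) = bits (B - A)"
  by (simp_all add: bor_def band_def bminus_def bits_def zip_map_map zip_same_conv_map)

lemma meets_bits: "meets (bits A) (bits B) \<longleftrightarrow> A \<inter> B \<inter> V \<noteq> {}"
  using set_vs by (auto simp: meets_def bits_def zip_map_map zip_same_conv_map)

lemma first_bit_bits: "first_bit (bits S) = bits (first S)"
  using first_bit_map[OF distinct_vs] by (simp add: bits_def first_def)

lemma unit_rows_bits: "unit_rows (length matrix) = map (\<lambda>v. bits {v}) vs"
  using unit_rows_map[OF distinct_vs] by (simp add: bits_def)

lemma first_cases:
  assumes "S \<inter> V \<noteq> {}"
  obtains v where "first S = {v}" "v \<in> S" "v \<in> V"
proof -
  have ne: "filter (\<lambda>v. v \<in> S) vs \<noteq> []" using assms set_vs by (auto simp: filter_empty_conv)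
  show thesis
    using hd_in_set[OF ne] set_vs ne by (intro that[of "hd (filter (\<lambda>v. v \<in> S) vs)"]) (auto simp: first_def)
qed

lemma step_subset: "step X \<subseteq> V \<times> V"
  using nb_V nb_sym by (auto simp: step_def)

text \<open>\<open>k\<close> rounds collect the powers of \<open>step X\<close> up to
  \<open>k\<close>, and for a finite relation the powers up to its cardinality already give the
  closure.\<close>

lemma spread_bits: "spread matrix (bits X) (bits Y) = bits ((step X)\<^sup>* `` Y)"
proof -
  define F where "F = (\<lambda>Z. bor (map (\<lambda>q. meets q (band (bits X) Z)) matrix) Z)"
  have F: "F (bits A) = bits (A \<union> step X `` A)" for A
  proof -
    have "meets (bits (nb v)) (bits (X \<inter> A)) \<longleftrightarrow> v \<in> step X `` A" for v
      using nb_sym nb_V unfolding meets_bits step_def by blast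
    then have "map (\<lambda>q. meets q (band (bits X) (bits A))) matrix = bits (step X `` A)"
      unfolding band_bits matrix_def by (simp add: bits_def)
    then show ?thesis by (simp add: F_def bor_bits Un_commute)
  qed
  have Fk: "(F ^^ k) (bits A) = bits ((\<Union>i\<le>k. step X ^^ i) `` A)" for k A
  proof (induction k)
    case (Suc k)
    have "(\<Union>i\<le>Suc k. step X ^^ i) = (\<Union>i\<le>k. step X ^^ i) \<union> (\<Union>i\<le>k. step X ^^ i) O step X"
    proof -
      have "(\<Union>i\<le>k. step X ^^ i) O step X = (\<Union>i\<le>k. step X ^^ Suc i)" by auto
      also have "\<dots> \<subseteq> (\<Union>i\<le>Suc k. step X ^^ i)" by (intro UN_least UN_upper) simp
      finally have 1: "(\<Union>i\<le>k. step X ^^ i) O step X \<subseteq> (\<Union>i\<le>Suc k. step X ^^ i)" .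
      have 2: "step X ^^ Suc k \<subseteq> (\<Union>i\<le>k. step X ^^ i) O step X" by auto
      have 3: "(\<Union>i\<le>Suc k. step X ^^ i) = (\<Union>i\<le>k. step X ^^ i) \<union> step X ^^ Suc k"
        unfolding atMost_Suc by (simp only: UN_insert Un_commute)
      have "A = U \<union> C" if "C \<subseteq> A" "R \<subseteq> C" "A = U \<union> R" for A U C R :: "('a \<times> 'a) set"
        using that by blast
      from this[OF 1 2 3] show ?thesis .
    qed
    then show ?case by (simp add: Suc F Un_Image relcomp_Image)
  qed simp
  have fin: "finite (step X)" using step_subset finite_V finite_subset by blast
  have "card (step X) \<le> card (V \<times> V)" using step_subset finite_V by (intro card_mono) auto
  also have "\<dots> = sum_list (map length matrix)"
    using distinct_card[OF distinct_vs] set_vs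
    by (simp add: card_cartesian_product matrix_def comp_def sum_list_triv)
  finally have card: "card (step X) \<le> sum_list (map length matrix)" .
  have "(\<Union>i\<le>sum_list (map length matrix). step X ^^ i) = (step X)\<^sup>*"
  proof
    show "(\<Union>i\<le>sum_list (map length matrix). step X ^^ i) \<subseteq> (step X)\<^sup>*"
      by (auto intro: relpow_imp_rtrancl)
    show "(step X)\<^sup>* \<subseteq> (\<Union>i\<le>sum_list (map length matrix). step X ^^ i)"
      unfolding rtrancl_finite_eq_relpow[OF fin] by (rule UN_mono) (use card in auto)
  qed
  moreover have "spread matrix (bits X) (bits Y) = (F ^^ sum_list (map length matrix)) (bits Y)"
    unfolding spread_def foldl_funpow foldl_funpow_lengths F_def ..
  ultimately show ?thesis by (simp add: Fk)
qed

lemma is_cds_bits: "X \<subseteq> V \<Longrightarrow> is_cds matrix (bits X) \<longleftrightarrow> cds X"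
proof -
  assume X: "X \<subseteq> V"
  show ?thesis
  proof (cases "X = {}")
    case True
    then show ?thesis by (auto simp: is_cds_def cds_def bits_def)
  next
    case False
    then obtain v where v: "first X = {v}" "v \<in> X" using X first_cases[of X] by blast
    have ex: "\<exists>b\<in>set (bits X). b" using v X set_vs by (auto simp: bits_def)
    have "is_cds matrix (bits X) \<longleftrightarrow> V \<subseteq> (step X)\<^sup>* `` {v}"
      using ex set_vs unfolding is_cds_def first_bit_bits spread_bits v(1) by (auto simp: bits_def)
    also have "\<dots> \<longleftrightarrow> cds X" using v X cds_reach[of X v] unfolding cds_def by blast
    finally show ?thesis .
  qed
qed

definition rep_set :: "'a set \<Rightarrow> 'a set" where
  "rep_set I = {v \<in> V. if v \<in> I then v \<in> first (I \<inter> (step I)\<^sup>* `` {v}) else nb v \<inter> I = {}}"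

lemma reps_bits:
  assumes "I \<subseteq> V"
  shows "reps matrix (bits I) = bits (rep_set I)"
proof -
  have *: "meets (bits {v}) (bits S) \<longleftrightarrow> v \<in> S" if "v \<in> V" for v S
    using that by (auto simp: meets_bits)
  have "reps matrix (bits I) = map (\<lambda>v. if meets (bits {v}) (bits I)
      then meets (bits {v}) (bits (first (I \<inter> (step I)\<^sup>* `` {v}))) else \<not> meets (bits (nb v)) (bits I)) vs"
    unfolding reps_def unit_rows_bits unfolding matrix_def zip_map_map
    unfolding matrix_def[symmetric]
    by (simp add: zip_same_conv_map spread_bits band_bits first_bit_bits)
  also have "\<dots> = bits (rep_set I)"
    unfolding bits_def[of "rep_set I"]
  proof (rule map_cong[OF refl])
    fix v assume "v \<in> set vs"
    then have v: "v \<in> V" using set_vs by simp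
    show "(if meets (bits {v}) (bits I)
      then meets (bits {v}) (bits (first (I \<inter> (step I)\<^sup>* `` {v}))) else \<not> meets (bits (nb v)) (bits I))
      \<longleftrightarrow> v \<in> rep_set I"
      using v assms by (auto simp: * rep_set_def) (auto simp: meets_bits)
  qed
  finally show ?thesis .
qed

text \<open>All vertices of a component of the graph induced by \<open>I\<close> see the same set
  \<open>?C\<close> and hence agree on its first element; existence and uniqueness both
  follow.\<close>

lemma representatives_rep_set:
  assumes I: "I \<subseteq> V"
  shows "representatives I (rep_set I)"
  unfolding representatives_def
proof (intro conjI ballI)
  show "rep_set I \<subseteq> V" "rep_set I - I = {v \<in> V - I. nb v \<inter> I = {}}"
    by (auto simp: rep_set_def)
next
  fix x assume x: "x \<in> I"
  let ?C = "\<lambda>x. I \<inter> (step I)\<^sup>* `` {x}"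
  have C: "?C z = ?C x" if "z \<in> I" "(z, x) \<in> (step I)\<^sup>*" for z
    using that rtrancl_step_sym[OF that(2) x] by (auto intro: rtrancl_trans)
  have "?C x \<inter> V \<noteq> {}" using x I by blast
  then obtain z where z: "first (?C x) = {z}" "z \<in> ?C x" "z \<in> V" by (rule first_cases)
  have zx: "(z, x) \<in> (step I)\<^sup>*" using z(2) rtrancl_step_sym by blast
  show "\<exists>!z. z \<in> rep_set I \<inter> I \<and> (z, x) \<in> (step I)\<^sup>*"
  proof (rule ex1I[of _ z])
    have "z \<in> first (?C z)" using z C[OF _ zx] by simp
    then show "z \<in> rep_set I \<inter> I \<and> (z, x) \<in> (step I)\<^sup>*" using z zx by (simp add: rep_set_def)
    fix z' assume z': "z' \<in> rep_set I \<inter> I \<and> (z', x) \<in> (step I)\<^sup>*"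
    then have "z' \<in> first (?C z')" by (simp add: rep_set_def)
    then show "z' = z" using z(1) C[of z'] z' by simp
  qed
qed

lemma at_most_twice_bits:
  assumes "A \<subseteq> V" "Z \<subseteq> V"
  shows "at_most_twice (bits A) (bits Z) \<longleftrightarrow> card A \<le> 2 * card Z"
proof -
  have "length (filter id (bits S)) = card S" if "S \<subseteq> V" for S
  proof -
    have "length (filter id (bits S)) = length (filter (\<lambda>v. v \<in> S) vs)"
      by (simp add: bits_def filter_map comp_def)
    also have "\<dots> = card (set (filter (\<lambda>v. v \<in> S) vs))"
      using distinct_vs by (simp only: distinct_card distinct_filter)
    also have "set (filter (\<lambda>v. v \<in> S) vs) = S" using that set_vs by auto
    finally show ?thesis .
  qed
  then show ?thesis using assms by (simp add: at_most_twice_iff)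
qed

definition minimal_in :: "'a set \<Rightarrow> 'a set \<Rightarrow> 'a set \<Rightarrow> bool" where
  "minimal_in I L S \<longleftrightarrow> S \<subseteq> L \<and> cds (I \<union> S) \<and> (\<forall>T. T \<subset> S \<longrightarrow> \<not> cds (I \<union> T))"

lemma minimal_in_iff:
  assumes "I \<subseteq> V" "L \<subseteq> V"
  shows "minimal_in I L S \<longleftrightarrow> S \<subseteq> L \<and> cds (I \<union> S) \<and> (\<forall>v\<in>S. \<not> cds (I \<union> (S - {v})))"
proof -
  have "\<not> cds (I \<union> T)" if S: "S \<subseteq> L" "\<forall>v\<in>S. \<not> cds (I \<union> (S - {v}))" and T: "T \<subset> S" for T
  proof
    assume c: "cds (I \<union> T)"
    obtain v where v: "v \<in> S" "v \<notin> T" using T by blast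
    have "cds (I \<union> (S - {v}))"
      by (rule cds_mono[OF c]) (use v T S assms in auto)
    then show False using S v by blast
  qed
  then show ?thesis unfolding minimal_in_def by blast
qed

lemma push_bits:
  assumes "I \<subseteq> V" "P \<subseteq> V" "X \<subseteq> V"
  shows "push matrix (bits I) (bits P) (bits X) out =
    (if cds (I \<union> X) \<and> card (X \<inter> P) \<le> 2 * card (rep_set I) then bits X # out else out)"
proof -
  have "rep_set I \<subseteq> V" by (auto simp: rep_set_def)
  then show ?thesis
    using assms is_cds_bits[of "I \<union> X"] at_most_twice_bits[of "P \<inter> X" "rep_set I"]
    by (simp add: push_def bor_bits band_bits reps_bits le_infI1 Int_commute[of P X])
qed

end

section \<open>The search loop and its invariant\<close>

lemma set_foldl_two_pushes:
  "set (foldl (\<lambda>out X. (\<lambda>Y out. if g Y then Y # out else out) (f X)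
      ((\<lambda>Y out. if g Y then Y # out else out) X out)) out Xs) =
    set out \<union> {Y \<in> set Xs \<union> f ` set Xs. g Y}"
  by (induction Xs arbitrary: out) auto

text \<open>Intended for \<open>f X = X - {v}\<close> with \<open>v\<close> in every
  \<open>X\<close>: deletion is then injective and never produces a set already in the list.\<close>

lemma distinct_foldl_two_pushes:
  assumes "distinct Xs" "inj_on f (set Xs)" "set Xs \<inter> f ` set Xs = {}" "distinct out"
    "set out \<inter> (set Xs \<union> f ` set Xs) = {}"
  shows "distinct (foldl (\<lambda>out X. (\<lambda>Y out. if g Y then Y # out else out) (f X)
      ((\<lambda>Y out. if g Y then Y # out else out) X out)) out Xs)"
  using assms
proof (induction Xs arbitrary: out)
  case (Cons X Xs)
  have "X \<noteq> f X" "X \<notin> f ` set Xs" "f X \<notin> set Xs" "f X \<notin> f ` set Xs"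
    using Cons.prems(1-3) by auto
  with Cons.prems show ?case
    unfolding foldl.simps by (intro Cons.IH) auto
qed simp

context listed_neighborhood
begin

text \<open>The loop invariant. Distinctness turns list lengths into cardinalities; the exception
  \<open>[L]\<close> is the untested start, which persists until the first vertex of
  \<open>L\<close> is decided. Each minimal \<open>S\<close> is tracked by its superset that still
  has all undecided vertices.\<close>

lemma search_bits:
  assumes I: "I \<subseteq> V" and L: "L \<subseteq> V" "I \<inter> L = {}" and us: "distinct us" "set us \<subseteq> V"
  shows "\<exists>Xs. foldl (branch matrix (bits I) (bits L)) ([bits L], bits {}) (map (\<lambda>v. bits {v}) us)
      = (map bits Xs, bits (L \<inter> set us)) \<and> distinct Xs \<and>
      (\<forall>X\<in>set Xs. X \<subseteq> L \<and> L - set us \<subseteq> X) \<and>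
      (Xs = [L] \<or> set Xs \<subseteq> candidates I (rep_set I) L (L \<inter> set us)) \<and>
      (\<forall>S. minimal_in I L S \<longrightarrow> S \<union> (L - set us) \<in> set Xs)"
  using us
proof (induction us rule: rev_induct)
  case Nil
  show ?case
    by (rule exI[of _ "[L]"]) (auto simp: minimal_in_def)
next
  case (snoc v us)
  have "distinct us" "set us \<subseteq> V" using snoc.prems by auto
  from snoc.IH[OF this] obtain Xs where st: "foldl (branch matrix (bits I) (bits L))
        ([bits L], bits {}) (map (\<lambda>v. bits {v}) us) = (map bits Xs, bits (L \<inter> set us))"
      and dist: "distinct Xs"
      and Xs': "\<forall>X\<in>set Xs. X \<subseteq> L \<and> L - set us \<subseteq> X"
      and cand: "Xs = [L] \<or> set Xs \<subseteq> candidates I (rep_set I) L (L \<inter> set us)"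
      and mins': "\<forall>S. minimal_in I L S \<longrightarrow> S \<union> (L - set us) \<in> set Xs"
    by blast
  have Xs: "X \<subseteq> L \<and> L - set us \<subseteq> X" if "X \<in> set Xs" for X
    using Xs' that by blast
  have mins: "S \<union> (L - set us) \<in> set Xs" if "minimal_in I L S" for S
    using mins' that by blast
  have v: "v \<in> V" "v \<notin> set us" using snoc.prems by auto
  show ?case
  proof (cases "v \<in> L")
    case False
    have "L - set (us @ [v]) = L - set us" "L \<inter> set (us @ [v]) = L \<inter> set us" using False by auto
    moreover have "\<not> meets (bits {v}) (bits L)" using False by (simp add: meets_bits)
    then have "branch matrix (bits I) (bits L) (map bits Xs, bits (L \<inter> set us)) (bits {v}) =
        (map bits Xs, bits (L \<inter> set us))"
      by (simp add: branch_def)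
    ultimately show ?thesis
      using st dist Xs cand mins by (intro exI[of _ Xs]) simp
  next
    case True
    define P where "P = L \<inter> set (us @ [v])"
    have P: "P = insert v (L \<inter> set us)" "P \<subseteq> V" using True L by (auto simp: P_def)
    define g where "g Y \<longleftrightarrow> cds (I \<union> Y) \<and> card (Y \<inter> P) \<le> 2 * card (rep_set I)" for Y
    define Ys where "Ys = foldl (\<lambda>out X. (\<lambda>Y out. if g Y then Y # out else out) (X - {v})
      ((\<lambda>Y out. if g Y then Y # out else out) X out)) [] Xs"
    have push: "foldl (\<lambda>out X. push matrix (bits I) (bits P) (bminus (bits {v}) X)
        (push matrix (bits I) (bits P) X out)) (map bits out) (map bits Xs') =
      map bits (foldl (\<lambda>out X. (\<lambda>Y out. if g Y then Y # out else out) (X - {v})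
        ((\<lambda>Y out. if g Y then Y # out else out) X out)) out Xs')"
      if "\<forall>X\<in>set Xs'. X \<subseteq> V" for Xs' out
      using that
    proof (induction Xs' arbitrary: out)
      case (Cons X Xs')
      have "X \<subseteq> V" "X - {v} \<subseteq> V" using Cons.prems by auto
      then have "push matrix (bits I) (bits P) (bminus (bits {v}) (bits X))
          (push matrix (bits I) (bits P) (bits X) (map bits out)) =
        map bits ((\<lambda>Y out. if g Y then Y # out else out) (X - {v})
          ((\<lambda>Y out. if g Y then Y # out else out) X out))"
        by (simp add: push_bits[OF I P(2)] bminus_bits g_def)
      then show ?case using Cons by simp
    qed simp
    \<comment> \<open>\<open>v\<close> is undecided, hence still in every alive set; this keeps the
      two branches apart.\<close>
    have vX: "v \<in> X" if "X \<in> set Xs" for X using Xs[OF that] True v by blast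
    have "meets (bits {v}) (bits L)" using True v by (simp add: meets_bits)
    moreover have "\<forall>X\<in>set Xs. X \<subseteq> V" using Xs L by blast
    ultimately have "branch matrix (bits I) (bits L) (map bits Xs, bits (L \<inter> set us)) (bits {v}) =
        (map bits Ys, bits P)"
      using push[of Xs "[]"] by (simp add: branch_def bor_bits Ys_def P(1))
    then have st': "foldl (branch matrix (bits I) (bits L)) ([bits L], bits {})
        (map (\<lambda>v. bits {v}) (us @ [v])) = (map bits Ys, bits P)"
      using st by simp
    have "distinct Ys"
      unfolding Ys_def
    proof (rule distinct_foldl_two_pushes[OF dist])
      show "inj_on (\<lambda>X. X - {v}) (set Xs)" using vX by (intro inj_onI) blast
    qed (use vX in auto)
    moreover have setY: "set Ys = {Y \<in> set Xs \<union> (\<lambda>X. X - {v}) ` set Xs. g Y}"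
      unfolding Ys_def using set_foldl_two_pushes[of g "\<lambda>X. X - {v}" "[]" Xs] by simp
    have sub: "Y \<subseteq> L \<and> L - set (us @ [v]) \<subseteq> Y" if "Y \<in> set Ys" for Y
    proof -
      from that consider "Y \<in> set Xs" | X where "X \<in> set Xs" "Y = X - {v}"
        unfolding setY by blast
      then show ?thesis using Xs by cases auto
    qed
    moreover have "set Ys \<subseteq> candidates I (rep_set I) L P"
    proof
      fix Y assume Y: "Y \<in> set Ys"
      then have "g Y" unfolding setY by blast
      moreover have "L - P \<subseteq> Y" using sub[OF Y] by (auto simp: P_def)
      ultimately show "Y \<in> candidates I (rep_set I) L P"
        using sub[OF Y] by (simp add: candidates_def g_def)
    qed
    moreover have "S \<union> (L - set (us @ [v])) \<in> set Ys" if S: "minimal_in I L S" for S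
    proof -
      let ?Y = "S \<union> (L - set (us @ [v]))"
      have SL: "S \<subseteq> L" using S by (simp add: minimal_in_def)
      have "?Y = S \<union> (L - set us) \<or> ?Y = (S \<union> (L - set us)) - {v}"
        using True v SL by (cases "v \<in> S") auto
      then have "?Y \<in> set Xs \<union> (\<lambda>X. X - {v}) ` set Xs" using mins[OF S] by auto
      \<comment> \<open>The tests never discard this set: connected domination passes to supersets,
        and its decided part lies in \<open>S\<close>, which the greedy argument bounds by twice the
        number of representatives.\<close>
      moreover have "g ?Y"
      proof -
        have "cds (I \<union> ?Y)"
          by (rule cds_mono[of "I \<union> S"]) (use S SL L I in \<open>auto simp: minimal_in_def\<close>)
        moreover have "card (?Y \<inter> P) \<le> card S"
          using SL finite_subset[OF subset_trans[OF SL L(1)] finite_V]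
          by (intro card_mono) (auto simp: P_def)
        moreover have "card S \<le> 2 * card (rep_set I)"
          using S SL L I by (intro card_minimal_extension_le[OF representatives_rep_set])
            (auto simp: minimal_in_def)
        ultimately show ?thesis by (simp add: g_def)
      qed
      ultimately show ?thesis unfolding setY by blast
    qed
    ultimately show ?thesis using st' unfolding P_def by (intro exI[of _ Ys]) blast
  qed
qed

text \<open>The \<open>+ 1\<close> pays for the untested start list, as \<open>L\<close> need not be
  a candidate.\<close>

lemma length_search_le:
  assumes I: "I \<subseteq> V" and L: "L \<subseteq> V" "I \<inter> L = {}"
    and B: "\<And>P. card (candidates I (rep_set I) L P) \<le> B"
  shows "length (search matrix (bits I) (bits L) (take j (unit_rows (length matrix)))) \<le> B + 1"
proof -
  have "distinct (take j vs)" "set (take j vs) \<subseteq> V"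
    using distinct_vs set_vs set_take_subset[of j vs] by auto
  from search_bits[OF I L this] obtain Xs where
    Xs: "foldl (branch matrix (bits I) (bits L)) ([bits L], bits {}) (map (\<lambda>v. bits {v}) (take j vs))
      = (map bits Xs, bits (L \<inter> set (take j vs)))" "distinct Xs"
      "Xs = [L] \<or> set Xs \<subseteq> candidates I (rep_set I) L (L \<inter> set (take j vs))" by blast
  have "search matrix (bits I) (bits L) (take j (unit_rows (length matrix))) = map bits Xs"
    using Xs(1) unfolding search_def unit_rows_bits take_map by (simp add: bits_def comp_def)
  moreover have "length Xs \<le> B + 1"
  proof (cases "Xs = [L]")
    case False
    have "length Xs = card (set Xs)" using Xs(2) by (simp add: distinct_card)
    also have "\<dots> \<le> card (candidates I (rep_set I) L (L \<inter> set (take j vs)))"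
      using False Xs(3) L finite_V finite_subset by (intro card_mono finite_candidates) auto
    finally show ?thesis using B[of "L \<inter> set (take j vs)"] by simp
  qed simp
  ultimately show ?thesis by simp
qed

lemma list_minimal_bits:
  assumes I: "I \<subseteq> V" and L: "L \<subseteq> V" "I \<inter> L = {}"
  obtains Ss where "distinct Ss" "set Ss = {S. minimal_in I L S}"
    "list_minimal matrix (bits I) (bits L) = map bits Ss"
proof -
  have "distinct vs" "set vs \<subseteq> V" using distinct_vs set_vs by auto
  from search_bits[OF I L this] obtain Xs where
    Xs: "foldl (branch matrix (bits I) (bits L)) ([bits L], bits {}) (map (\<lambda>v. bits {v}) vs)
      = (map bits Xs, bits (L \<inter> set vs))" "distinct Xs" "\<forall>X\<in>set Xs. X \<subseteq> L \<and> L - set vs \<subseteq> X"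
      "\<forall>S. minimal_in I L S \<longrightarrow> S \<union> (L - set vs) \<in> set Xs" by blast
  have search: "search matrix (bits I) (bits L) (unit_rows (length matrix)) = map bits Xs"
    using Xs(1) unfolding search_def unit_rows_bits by (simp add: bits_def comp_def)
  have is_min: "is_minimal matrix (bits I) (bits X) \<longleftrightarrow> minimal_in I L X" if "X \<subseteq> L" for X
  proof -
    have "is_cds matrix (bits (I \<union> X)) \<longleftrightarrow> cds (I \<union> X)"
      using that I L by (intro is_cds_bits) auto
    moreover have "is_cds matrix (bits (I \<union> (X - {v}))) \<longleftrightarrow> cds (I \<union> (X - {v}))" for v
      using that I L by (intro is_cds_bits) auto
    moreover have "meets (bits {v}) (bits X) \<longleftrightarrow> v \<in> X" for v
      using that L by (auto simp: meets_bits)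
    moreover have "set vs \<inter> X = X" using that L set_vs by auto
    ultimately show ?thesis
      using that set_vs L unfolding is_minimal_def unit_rows_bits minimal_in_iff[OF I L(1)]
      by (auto simp: bor_bits bminus_bits)
  qed
  have fold: "foldl (\<lambda>out X. if is_minimal matrix (bits I) X then X # out else out) (map bits out) (map bits Xs')
      = map bits (rev (filter (minimal_in I L) Xs') @ out)" if "\<forall>X\<in>set Xs'. X \<subseteq> L" for Xs' out
    using that
  proof (induction Xs' arbitrary: out)
    case (Cons X Xs')
    then show ?case using Cons.IH[of out] Cons.IH[of "X # out"] is_min[of X] by simp
  qed simp
  let ?Ss = "rev (filter (minimal_in I L) Xs)"
  have "list_minimal matrix (bits I) (bits L) = map bits ?Ss"
    unfolding list_minimal_def search using fold[of Xs "[]"] Xs(3) by simp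
  moreover have "set ?Ss = {S. minimal_in I L S}"
  proof -
    have "S \<in> set Xs" if "minimal_in I L S" for S
    proof -
      have "L - set vs = {}" using L set_vs by auto
      then show ?thesis using Xs(4) that by (metis Un_empty_right)
    qed
    then show ?thesis by auto
  qed
  moreover have "distinct ?Ss" using Xs(2) by simp
  ultimately show thesis by (intro that[of ?Ss]) auto
qed

end

section \<open>Graphs\<close>

lemma (in graph) neighborhood: "finite_symmetric_neighborhood (verts G) (neighbors G)"
proof
  show "finite (verts G)" by (rule finite_verts)
  show "neighbors G u \<subseteq> verts G" for u by (auto simp: neighbors_def arcs_ends_conv)
  show "u \<in> neighbors G v" if "v \<in> neighbors G u" for u v
    using that arcs_ends_symmetric[OF sym_arcs] by (simp add: neighbors_def)
qed

text \<open>\<open>rtrancl_on X\<close> stays inside \<open>X\<close>, whereas \<open>step X\<close>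
  may leave it in the last step; that last step is exactly domination.\<close>

lemma (in graph) connected_dominating_set_iff:
  "connected_dominating_set G X \<longleftrightarrow>
    finite_symmetric_neighborhood.cds (verts G) (neighbors G) X"
proof -
  interpret nb: finite_symmetric_neighborhood "verts G" "neighbors G" by (rule neighborhood)
  let ?r = "(arcs_ends (G \<restriction> X))\<^sup>s"
  have r: "?r = {(a, b). a \<in> X \<and> b \<in> X \<and> b \<in> neighbors G a}"
  proof -
    have "arcs_ends (G \<restriction> X) = {(a, b). a \<in> X \<and> b \<in> X \<and> b \<in> neighbors G a}"
      by (auto simp: arcs_ends_conv neighbors_def)
    then show ?thesis using nb.nb_sym by (auto simp: symcl_def)
  qed
  have r_step: "(u, v) \<in> (nb.step X)\<^sup>*" if "(u, v) \<in> rtrancl_on X ?r" for u v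
  proof -
    have "(u, v) \<in> ?r\<^sup>*" using that by (rule rtrancl_on_rtranclI)
    moreover have "?r \<subseteq> nb.step X" unfolding r nb.step_def by auto
    ultimately show ?thesis by (metis rtrancl_mono subsetD)
  qed
  have step_r: "(u, v) \<in> rtrancl_on X ?r" if "(u, v) \<in> (nb.step X)\<^sup>*" "u \<in> X" "v \<in> X" for u v
    using that
  proof (induction rule: rtrancl_induct)
    case base
    then show ?case by simp
  next
    case (step y z)
    then have y: "y \<in> X" "(y, z) \<in> ?r" by (auto simp: r nb.step_def)
    have "(u, y) \<in> rtrancl_on X ?r" using step.IH step.prems y(1) by simp
    then show ?case using y(2) step.prems(2) by (rule rtrancl_on_into_rtrancl_on)
  qed
  have conn: "Digraph_Component.connected (G \<restriction> X) \<longleftrightarrow>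
      X \<noteq> {} \<and> (\<forall>u\<in>X. \<forall>v\<in>X. (u, v) \<in> rtrancl_on X ?r)"
    by (simp add: connected_conv)
  show ?thesis
  proof
    assume cd: "connected_dominating_set G X"
    then have X: "X \<subseteq> verts G" "X \<noteq> {}"
      and dom: "\<forall>v\<in>verts G - X. \<exists>u\<in>X. u \<in> neighbors G v"
      and on: "\<forall>u\<in>X. \<forall>v\<in>X. (u, v) \<in> rtrancl_on X ?r"
      unfolding connected_dominating_set_def conn by simp_all
    then obtain u where u: "u \<in> X" by blast
    have reach: "(u, v) \<in> (nb.step X)\<^sup>*" if "v \<in> X" for v
      using on u that by (intro r_step) simp
    have "(u, v) \<in> (nb.step X)\<^sup>*" if "v \<in> verts G" for v
    proof (cases "v \<in> X")
      case True
      then show ?thesis by (rule reach)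
    next
      case False
      with dom that obtain w where "w \<in> X" "w \<in> neighbors G v" by blast
      then have "(w, v) \<in> nb.step X" using nb.nb_sym by (simp add: nb.step_def)
      with reach[OF \<open>w \<in> X\<close>] show ?thesis by (rule rtrancl_into_rtrancl)
    qed
    then show "nb.cds X" using u X unfolding nb.cds_def by blast
  next
    assume cds: "nb.cds X"
    then have X: "X \<subseteq> verts G" "X \<noteq> {}" unfolding nb.cds_def by auto
    have "\<exists>u\<in>X. u \<in> neighbors G v" if v: "v \<in> verts G - X" for v
    proof -
      obtain u where u: "u \<in> X" using X by blast
      then have "(u, v) \<in> (nb.step X)\<^sup>*" "u \<noteq> v" using nb.cds_reach[OF cds] v by auto
      then obtain y where "(y, v) \<in> nb.step X" by (metis rtranclE)
      then show ?thesis using nb.nb_sym by (auto simp: nb.step_def)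
    qed
    moreover have "(u, v) \<in> rtrancl_on X ?r" if "u \<in> X" "v \<in> X" for u v
      using nb.cds_reach[OF cds that(1)] X that by (intro step_r) auto
    ultimately show "connected_dominating_set G X"
      using X unfolding connected_dominating_set_def conn by blast
  qed
qed

lemma minimal_extension_iff:
  assumes inst: "extension_instance l G L H R In Out"
    and nb: "listed_neighborhood (verts G) (neighbors G) vs"
  shows "minimal_extension G In Out S \<longleftrightarrow>
    listed_neighborhood.minimal_in (verts G) (neighbors G) In L S"
proof -
  interpret nb: listed_neighborhood "verts G" "neighbors G" vs by (rule nb)
  have G: "graph G" using inst by (simp add: extension_instance_def)
  have sets: "L \<union> H \<union> R = verts G" "L \<inter> H = {}" "L \<inter> R = {}" "In \<union> Out = H \<union> R"
    using inst by (auto simp: extension_instance_def)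
  have "extension G In Out T \<longleftrightarrow> T \<subseteq> L \<and> nb.cds (In \<union> T)" for T
  proof -
    have "T \<subseteq> verts G \<and> T \<inter> (In \<union> Out) = {} \<longleftrightarrow> T \<subseteq> L" using sets by blast
    then show ?thesis
      unfolding extension_def graph.connected_dominating_set_iff[OF G] by meson
  qed
  moreover have "T \<subseteq> L" if "T \<subset> S" "S \<subseteq> L" for T using that by blast
  ultimately show ?thesis
    unfolding minimal_extension_def nb.minimal_in_def by meson
qed

definition extension_bound :: "nat \<Rightarrow> nat \<Rightarrow> real" where
  "extension_bound m l = 2 ^ m * exp (- (real m / (2 ^ (10 * l) * 100 * real l ^ 3)))"

text \<open>The count allows no constant factor, whereas the running time can hide the 16 in its
  polynomial; hence two bounds.\<close>

lemma extension_instance_bounds: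
  assumes inst: "extension_instance l G L H R In Out"
    and nb: "listed_neighborhood (verts G) (neighbors G) vs"
  shows "real (card {S. minimal_extension G In Out S}) \<le> extension_bound (card L) l"
    and "real (card (finite_symmetric_neighborhood.candidates (verts G) (neighbors G) In
      (listed_neighborhood.rep_set (verts G) (neighbors G) vs In) L P))
        \<le> 16 * extension_bound (card L) l"
proof -
  interpret nb: listed_neighborhood "verts G" "neighbors G" vs by (rule nb)
  have l: "l \<ge> 1" and H: "10 * card H * l \<le> card L"
    and deg: "\<And>v. v \<in> L \<Longrightarrow> card (neighbors G v \<inter> (L \<union> R)) < l"
    and V: "verts G = L \<union> H \<union> R" and I: "In \<subseteq> verts G" "In \<inter> L = {}"
    using inst by (auto simp: extension_instance_def)
  have L: "L \<subseteq> verts G" "finite L" using V nb.finite_V by auto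
  let ?Z = "nb.rep_set In"
  note Z = nb.representatives_rep_set[OF I(1)]
  have one: "1 \<le> extension_bound (card L) l"
    unfolding extension_bound_def using l by (rule bound_ge_one)
  have few: "real (card (nb.candidates In ?Z L P)) \<le> extension_bound (card L) l"
    if "\<not> nb.cds In" for P
    unfolding extension_bound_def using nb.card_candidates_le[OF Z I V deg H l that] .
  show "real (card {S. minimal_extension G In Out S}) \<le> extension_bound (card L) l"
    unfolding minimal_extension_iff[OF inst nb]
  proof (cases "nb.cds In")
    case True
    \<comment> \<open>The empty set is itself an extension here, so no other one is minimal.\<close>
    have "S = {}" if "nb.minimal_in In L S" for S
      using that True unfolding nb.minimal_in_def by (metis Un_empty_right psubsetI empty_subsetI)
    then have "card {S. nb.minimal_in In L S} \<le> card {{} :: 'a set}" by (intro card_mono) auto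
    then show "real (card {S. nb.minimal_in In L S}) \<le> extension_bound (card L) l" using one by simp
  next
    case False
    have "{S. nb.minimal_in In L S} \<subseteq> nb.candidates In ?Z L L"
    proof
      fix S assume "S \<in> {S. nb.minimal_in In L S}"
      then have S: "S \<subseteq> L" "nb.cds (In \<union> S)" "\<And>T. T \<subset> S \<Longrightarrow> \<not> nb.cds (In \<union> T)"
        by (auto simp: nb.minimal_in_def)
      have "card S \<le> 2 * card ?Z"
        using nb.card_minimal_extension_le[OF Z I(1) _ S(2,3)] S(1) L by auto
      then show "S \<in> nb.candidates In ?Z L L"
        using S by (simp add: nb.candidates_def Int_absorb2)
    qed
    then have "card {S. nb.minimal_in In L S} \<le> card (nb.candidates In ?Z L L)"
      by (intro card_mono nb.finite_candidates L)
    then show "real (card {S. nb.minimal_in In L S}) \<le> extension_bound (card L) l"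
      using few[OF False, of L] by linarith
  qed
  show "real (card (nb.candidates In ?Z L P)) \<le> 16 * extension_bound (card L) l"
  proof (cases "nb.cds In")
    case True
    then show ?thesis
      unfolding extension_bound_def by (rule nb.card_candidates_le_cds[OF Z L(2) l])
  next
    case False
    then show ?thesis using few[OF False, of P] one by linarith
  qed
qed

text \<open>Nested pairs ending in \<open>unit\<close> have the same encoding as the list of fields
  in \<open>encode_instance\<close>: \<open>unit\<close> stands for the final nil, and
  \<open>unit list\<close> for the unary \<open>l\<close>.\<close>

type_synonym bit_instance =
  "unit list \<times> bool list list \<times> bool list \<times> bool list \<times> bool list \<times> bool list \<times> bool list \<times> unit"

definition instance_domain :: "nat \<Rightarrow> nat \<Rightarrow> bit_instance \<Rightarrow> bool" where
  "instance_domain n B = (\<lambda>(l, M, L, H, R, I, Out, u).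
     length M \<le> n \<and> (\<forall>r\<in>set M. length r \<le> n) \<and> length I \<le> n \<and> length L \<le> n \<and>
     (\<forall>j. length (search M I L (take j (unit_rows (length M)))) \<le> B + 1))"

lemma feasible_listing:
  "feasible 1 instance_domain (\<lambda>x. list_minimal (fst (snd x)) (fst (snd (snd (snd (snd (snd x))))))
     (fst (snd (snd x))))"
  by (intro feasible_list_minimal feasible_fst feasible_snd feasible_id)
    (auto simp: instance_domain_def)

lemma enc_nat_unary: "enc (replicate l ()) = encode_nat l"
  by (simp add: enc_list_def encode_nat_def enc_unit_def)

context listed_neighborhood
begin

lemma enc_bits: "enc (bits S) = encode_set vs S"
proof -
  have "(enc :: bool \<Rightarrow> data) = encode_bool" by (rule ext) (rule enc_bool_def)
  then show ?thesis by (simp add: enc_list_def encode_set_def bits_def comp_def)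
qed

lemma enc_map_bits: "enc (map bits Ss) = encode_list (map (encode_set vs) Ss)"
  by (induction Ss) (simp_all add: enc_bits encode_list_def)

lemma enc_matrix:
  assumes "nb = neighbors G"
  shows "enc matrix = encode_graph vs G"
  unfolding matrix_def encode_graph_def assms[symmetric]
  using enc_map_bits[of "map nb vs"] by (simp add: comp_def)

end

theorem lemma11:
  shows
    "(\<forall>l (G :: ('a, 'b) pre_digraph) L H R In Out.
        extension_instance l G L H R In Out \<longrightarrow>
        real (card {S. minimal_extension G In Out S})
          \<le> 2 ^ card L * exp (- (real (card L) / (2 ^ (10 * l) * 100 * real l ^ 3))))
     \<and>
     (\<exists>(p :: prog) (c :: nat).
        \<forall>l (G :: ('a, 'b) pre_digraph) L H R In Out vs.
          extension_instance l G L H R In Out \<and> distinct vs \<and> set vs = verts G \<longrightarrow>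
          (\<exists>t. lists_in_time p (encode_instance vs l G L H R In Out) vs
                 {S. minimal_extension G In Out S} t \<and>
               real t \<le> 2 ^ card L * exp (- (real (card L) / (2 ^ (10 * l) * 100 * real l ^ 3)))
                        * (real c * real (card (verts G) + 1) ^ c)))"
proof -
  have listed: "listed_neighborhood (verts G) (neighbors G) vs"
    if "extension_instance l G L H R In Out" "distinct vs" "set vs = verts G"
    for l and G :: "('a, 'b) pre_digraph" and L H R In Out vs
  proof -
    have "graph G" using that(1) by (simp add: extension_instance_def)
    from graph.neighborhood[OF this] show ?thesis
      using that(2,3) by (simp add: listed_neighborhood_def listed_neighborhood_axioms_def)
  qed
  have count: "real (card {S. minimal_extension G In Out S}) \<le> extension_bound (card L) l"
    if inst: "extension_instance l G L H R In Out"
    for l and G :: "('a, 'b) pre_digraph" and L H R In Out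
  proof -
    have "graph G" using inst by (simp add: extension_instance_def)
    then interpret graph G .
    \<comment> \<open>Any enumeration will do: the representatives depend on it, the count does
      not.\<close>
    obtain vs where "set vs = verts G" "distinct vs"
      using finite_distinct_list[OF finite_verts] by blast
    then show ?thesis using extension_instance_bounds(1)[OF inst listed[OF inst]] by blast
  qed
  obtain p c where p: "\<And>n B x s. instance_domain n B x \<Longrightarrow> s 0 = enc x \<Longrightarrow>
     \<exists>t s'. exec p s t s' \<and> s' 0 = enc (list_minimal (fst (snd x))
        (fst (snd (snd (snd (snd (snd x)))))) (fst (snd (snd x)))) \<and>
       t \<le> c * (n + 1) ^ c * (B + 1) ^ 1"
    using feasible_listing by (rule feasibleE) (rule that)
  have time: "\<exists>t. lists_in_time p (encode_instance vs l G L H R In Out) vs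
        {S. minimal_extension G In Out S} t \<and>
      real t \<le> extension_bound (card L) l * (real (17 * c) * real (card (verts G) + 1) ^ (17 * c))"
    if inst: "extension_instance l G L H R In Out" and vs: "distinct vs" "set vs = verts G"
    for l and G :: "('a, 'b) pre_digraph" and L H R In Out vs
  proof -
    interpret nb: listed_neighborhood "verts G" "neighbors G" vs by (rule listed[OF inst vs])
    have sets: "In \<subseteq> verts G" "L \<subseteq> verts G" "In \<inter> L = {}" and l: "l \<ge> 1"
      using inst by (auto simp: extension_instance_def)
    define b where "b = extension_bound (card L) l"
    have b1: "1 \<le> b" unfolding b_def extension_bound_def using l by (rule bound_ge_one)
    \<comment> \<open>Cardinalities are integers, so rounding down keeps the bound. As
      \<open>b\<close> is at least 1, \<open>B + 1\<close> is at most \<open>17 * b\<close>, and the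
      factor 17 moves into the polynomial.\<close>
    define B where "B = nat \<lfloor>16 * b\<rfloor>"
    have B: "card (nb.candidates In (nb.rep_set In) L P) \<le> B" for P
      using extension_instance_bounds(2)[OF inst nb.listed_neighborhood_axioms, of P]
      unfolding B_def b_def by (simp add: le_nat_floor)
    let ?n = "card (verts G)"
    have n: "length vs = ?n" using distinct_card[OF vs(1)] vs(2) by simp
    let ?x = "(replicate l (), nb.matrix, nb.bits L, nb.bits H, nb.bits R, nb.bits In, nb.bits Out, ())"
    have enc: "enc ?x = encode_instance vs l G L H R In Out"
      by (simp add: encode_instance_def nb.enc_bits nb.enc_matrix enc_nat_unary enc_unit_def
          encode_list_def)
    have "instance_domain ?n B ?x"
      using nb.length_search_le[OF sets(1,2,3) B] n
      by (auto simp: instance_domain_def nb.matrix_def)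
    from p[OF this, of "(\<lambda>_. DNil)(0 := enc ?x)"]
    obtain t s' where t: "exec p ((\<lambda>_. DNil)(0 := enc ?x)) t s'"
        "s' 0 = enc (list_minimal nb.matrix (nb.bits In) (nb.bits L))"
        "t \<le> c * (?n + 1) ^ c * (B + 1)" by auto
    obtain Ss where Ss: "distinct Ss" "set Ss = {S. nb.minimal_in In L S}"
        "list_minimal nb.matrix (nb.bits In) (nb.bits L) = map nb.bits Ss"
      using sets by (rule nb.list_minimal_bits)
    have "lists_in_time p (encode_instance vs l G L H R In Out) vs {S. minimal_extension G In Out S} t"
      unfolding lists_in_time_def computes_in_time_def
        minimal_extension_iff[OF inst nb.listed_neighborhood_axioms]
      using t(1,2) Ss enc nb.enc_map_bits by metis
    moreover have "real t \<le> b * (real (17 * c) * real (?n + 1) ^ (17 * c))"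
    proof -
      have "real t \<le> real (c * (?n + 1) ^ c * (B + 1))" using t(3) by (simp only: of_nat_le_iff)
      also have "\<dots> = (real c * real (?n + 1) ^ c) * (real B + 1)"
        by (simp add: algebra_simps)
      also have "\<dots> \<le> (real c * real (?n + 1) ^ (17 * c)) * (17 * b)"
      proof (intro mult_mono power_increasing)
        have "real B \<le> 16 * b" unfolding B_def using b1 by simp
        then show "real B + 1 \<le> 17 * b" using b1 by linarith
      qed auto
      finally show ?thesis by (simp add: mult_ac)
    qed
    ultimately show ?thesis unfolding b_def by blast
  qed
  show ?thesis
    using count time unfolding extension_bound_def by blast
qed

end
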